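(* Let $P_0(t),H_0(t)\in\mathbb{R}$ be estimates of the power and heat demand and let $\Delta P(t),\Delta H(t)\ge 0$ be bounds on the estimation errors, $t=1,\dots,T$. Suppose that the set $\mathcal{W}$ is given by $$\mathcal{W}=\Big\{(P(t),H(t))_{t=1}^T\in\mathbb{R}^{2T}:\ |P(t)-P_0(t)|\le\Delta P(t),\ |H(t)-H_0(t)|\le\Delta H(t)\ \ \forall t=1,\dots,T\Big\}.$$ Then the robust economic dispatch problem with uncertainty set $\mathcal{W}$, namely $\min_{p\in\mathrm{PATH}_{s\to q}(\mathcal{G})}\max_{\xi\in\mathcal{W}}\sum_{e\in p}w_e(\xi)$, is equivalent to the economic dispatch problem with known demand $P(t)=P_0(t)+\Delta P(t)$, $H(t)=H_0(t)+\Delta H(t)$, namely to the shortest-path problem $$\min_{p\in\mathrm{PATH}_{s\to q}(\mathcal{G})}\ \sum_{e\in p}w_e(\bar\xi),\qquad \bar\xi=(P_0(t)+\Delta P(t),\,H_0(t)+\Delta H(t))_{t=1}^T .$$ Thus, it can be solved in $O(|\mathcal{E}|)=O\big(\max_{x,u}c(x,u)\,|\mathcal{X}|\,T\big)$ time.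
   Context: Turbine model: $\mathcal{X}$ is a finite set of states; for each $x\in\mathcal{X}$, $\mathcal{U}(x)$ is the set of admissible controls at $x$; applying $u\in\mathcal{U}(x)$ at $x$ leads to the state $f(x,u)\in\mathcal{X}$ after $c(x,u)\in\{1,2,\dots\}$ time steps. $C_{\rm MGT}(x,u)$ is the operating cost of this transition, and $P_{\rm MGT}(x,u),H_{\rm MGT}(x,u)$ are the power and heat generated per time step. $T\in\mathbb{N}$ is the horizon. For each $t\in\{1,\dots,T\}$, $C^P_{U,t},C^H_{U,t}:\mathbb{R}\to\mathbb{R}\cup\{+\infty\}$ are the costs of purchasing power and heat from a utility (negative arguments mean selling power or exhausting heat; an infinite cost models inability to sell power); each is non-decreasing on the set where it is finite, and $C^H_{U,t}(x)=0$ for $x<0$. A demand profile is $\xi=(P(t),H(t))_{t=1}^T\in\mathbb{R}^{2T}$. Graph: $\mathcal{G}=(\mathcal{V},\mathcal{E})$ is the finite directed acyclic graph whose vertices are the pairs $(t,x)$, $t\in\{1,\dots,T\}$, $x\in\mathcal{X}$, together with a source $s$ and a terminal $q$. There is an edge $e=(t_1,x_1)\to(t_2,x_2)$ whenever there is some $u_1\in\mathcal{U}(x_1)$ with $f(x_1,u_1)=x_2$ and $t_2=t_1+c(x_1,u_1)$; its cost is $$w_e(\xi)=C_{\rm MGT}(x_1,u_1)+\sum_{t=t_1}^{t_2}\big[C^P_{U,t}(P(t)-P_{\rm MGT}(x_1,u_1))+C^H_{U,t}(H(t)-H_{\rm MGT}(x_1,u_1))\big].$$ For every $x\in\mathcal{X}$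 there are also edges $s\to(1,x)$ and $(T,x)\to q$ of cost zero. $\mathrm{PATH}_{s\to q}(\mathcal{G})$ is the set of directed paths from $s$ to $q$; such paths correspond to turbine schedules. The economic dispatch problem with known demand $\xi$ is the problem of finding $p\in\mathrm{PATH}_{s\to q}(\mathcal{G})$ minimizing $\sum_{e\in p}w_e(\xi)$. Standing property of the edge costs: for every edge $e$, if $(\xi_1)_k\le(\xi_2)_k$ for all $k=1,\dots,2T$, then $w_e(\xi_1)\le w_e(\xi_2)$.
   Formalization: The bound |E| = O(max c |X| T) is false with an absolute constant (U(x)=X, f(x,u)=u, c=1 gives about T|X|^2 edges); it is proved, for each m, for all models with |U(x)| ≤ m·max c at every x. The O(|E|) time takes the edge costs as given input. *)

theory Defs
  imports
    "Graph_Theory.Arc_Walk"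
    "HOL-Library.FuncSet"
    "HOL-Library.Extended_Real"
    "HOL-Library.Landau_Symbols"
begin

section \<open>Turbine model and demand profiles\<close>

record ('x, 'u) turbine =
  horizon :: nat                               (* T *)
  states :: "'x set"                           (* X *)
  controls :: "'x \<Rightarrow> 'u set"                 (* U(x) *)
  succ_state :: "'x \<Rightarrow> 'u \<Rightarrow> 'x"             (* f(x,u) *)
  duration :: "'x \<Rightarrow> 'u \<Rightarrow> nat"              (* c(x,u) *)
  op_cost :: "'x \<Rightarrow> 'u \<Rightarrow> real"              (* C_MGT(x,u) *)
  gen_power :: "'x \<Rightarrow> 'u \<Rightarrow> real"                (* P_MGT(x,u) *)
  gen_heat :: "'x \<Rightarrow> 'u \<Rightarrow> real"                 (* H_MGT(x,u) *)
  utility_power :: "nat \<Rightarrow> real \<Rightarrow> ereal"     (* C^P_{U,t} *)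
  utility_heat :: "nat \<Rightarrow> real \<Rightarrow> ereal"      (* C^H_{U,t} *)

definition turbine_model :: "('x, 'u) turbine \<Rightarrow> bool" where
  "turbine_model M \<longleftrightarrow>
     1 \<le> horizon M \<and>
     finite (states M) \<and>
     (\<forall>x\<in>states M. finite (controls M x)) \<and>
     (\<forall>x\<in>states M. \<forall>u\<in>controls M x. succ_state M x u \<in> states M \<and> 1 \<le> duration M x u) \<and>
     (\<forall>t\<in>{1..horizon M}.
        (\<forall>a. utility_power M t a \<noteq> -\<infinity>) \<and>
        (\<forall>a. utility_heat M t a \<noteq> -\<infinity>) \<and>
        mono_on {a. utility_power M t a \<noteq> \<infinity>} (utility_power M t) \<and>
        mono_on {a. utility_heat M t a \<noteq> \<infinity>} (utility_heat M t) \<and>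
        (\<forall>a<0. utility_heat M t a = 0))"

type_synonym profile = "(nat \<Rightarrow> real) \<times> (nat \<Rightarrow> real)"

text \<open>The space \<open>\<real>\<^sup>2\<^sup>T\<close>: pairs \<open>(P, H)\<close> of functions on \<open>{1..T}\<close>.\<close>
definition profiles :: "nat \<Rightarrow> profile set" where
  "profiles T = ({1..T} \<rightarrow>\<^sub>E UNIV) \<times> ({1..T} \<rightarrow>\<^sub>E UNIV)"

definition demand_box :: "nat \<Rightarrow> (nat \<Rightarrow> real) \<Rightarrow> (nat \<Rightarrow> real) \<Rightarrow> (nat \<Rightarrow> real) \<Rightarrow> (nat \<Rightarrow> real) \<Rightarrow> profile set"
  where
  "demand_box T P\<^sub>0 H\<^sub>0 \<Delta>P \<Delta>H =
     {(P, H) \<in> profiles T. \<forall>t\<in>{1..T}. \<bar>P t - P\<^sub>0 t\<bar> \<le> \<Delta>P t \<and> \<bar>H t - H\<^sub>0 t\<bar> \<le> \<Delta>H t}"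

definition worst_profile ::
  "nat \<Rightarrow> (nat \<Rightarrow> real) \<Rightarrow> (nat \<Rightarrow> real) \<Rightarrow> (nat \<Rightarrow> real) \<Rightarrow> (nat \<Rightarrow> real) \<Rightarrow> profile" where
  "worst_profile T P\<^sub>0 H\<^sub>0 \<Delta>P \<Delta>H =
     (restrict (\<lambda>t. P\<^sub>0 t + \<Delta>P t) {1..T}, restrict (\<lambda>t. H\<^sub>0 t + \<Delta>H t) {1..T})"


section \<open>The time-expanded graph\<close>

datatype 'x vertex = Source | At nat 'x | Terminal

text \<open>
  The cost of a transition depends on the control and not only on the two end vertices, so there is
  one arc \<open>Step t x u\<close> for each admissible control \<open>u\<close>.  Controls with the same successor and
  duration give parallel arcs.
\<close>
datatype ('x, 'u) arc = Start 'x | Step nat 'x 'u | Stop 'x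

definition dispatch_graph :: "('x, 'u) turbine \<Rightarrow> ('x vertex, ('x, 'u) arc) pre_digraph" where
  "dispatch_graph M =
     \<lparr> verts = {Source, Terminal} \<union> {At t x |t x. t \<in> {1..horizon M} \<and> x \<in> states M},
       arcs = Start ` states M \<union> Stop ` states M \<union>
         {Step t x u |t x u. 1 \<le> t \<and> t + duration M x u \<le> horizon M \<and>
            x \<in> states M \<and> u \<in> controls M x},
       tail = case_arc (\<lambda>x. Source) (\<lambda>t x u. At t x) (\<lambda>x. At (horizon M) x),
       head = case_arc (\<lambda>x. At 1 x) (\<lambda>t x u. At (t + duration M x u) (succ_state M x u))
                (\<lambda>x. Terminal) \<rparr>"

fun arc_cost :: "('x, 'u) turbine \<Rightarrow> profile \<Rightarrow> ('x, 'u) arc \<Rightarrow> ereal" where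
  "arc_cost M \<xi> (Start x) = 0"
| "arc_cost M \<xi> (Stop x) = 0"
| "arc_cost M \<xi> (Step t\<^sub>1 x u) = ereal (op_cost M x u) +
     (\<Sum>t = t\<^sub>1..t\<^sub>1 + duration M x u.
        utility_power M t (fst \<xi> t - gen_power M x u) + utility_heat M t (snd \<xi> t - gen_heat M x u))"

text \<open>
  A genuine assumption: utility costs are only required to be monotone where they are finite.
\<close>
definition monotone_arc_costs :: "('x, 'u) turbine \<Rightarrow> bool" where
  "monotone_arc_costs M \<longleftrightarrow>
     (\<forall>e\<in>arcs (dispatch_graph M). \<forall>\<xi>\<^sub>1\<in>profiles (horizon M). \<forall>\<xi>\<^sub>2\<in>profiles (horizon M).
        (\<forall>t\<in>{1..horizon M}. fst \<xi>\<^sub>1 t \<le> fst \<xi>\<^sub>2 t \<and> snd \<xi>\<^sub>1 t \<le> snd \<xi>\<^sub>2 t) \<longrightarrow>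
        arc_cost M \<xi>\<^sub>1 e \<le> arc_cost M \<xi>\<^sub>2 e)"

definition dispatch_model :: "('x, 'u) turbine \<Rightarrow> bool" where
  "dispatch_model M \<longleftrightarrow> turbine_model M \<and> monotone_arc_costs M"

definition error_bounds :: "nat \<Rightarrow> (nat \<Rightarrow> real) \<Rightarrow> (nat \<Rightarrow> real) \<Rightarrow> bool" where
  "error_bounds T \<Delta>P \<Delta>H \<longleftrightarrow> (\<forall>t\<in>{1..T}. 0 \<le> \<Delta>P t \<and> 0 \<le> \<Delta>H t)"

definition dispatch_paths :: "('x, 'u) turbine \<Rightarrow> ('x, 'u) arc list set" where
  "dispatch_paths M = {p. pre_digraph.apath (dispatch_graph M) Source p Terminal}"

definition path_cost :: "('x, 'u) turbine \<Rightarrow> profile \<Rightarrow> ('x, 'u) arc list \<Rightarrow> ereal" where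
  "path_cost M \<xi> p = (\<Sum>e\<in>set p. arc_cost M \<xi> e)"

definition robust_cost :: "('x, 'u) turbine \<Rightarrow> profile set \<Rightarrow> ('x, 'u) arc list \<Rightarrow> ereal" where
  "robust_cost M W p = (SUP \<xi>\<in>W. path_cost M \<xi> p)"

text \<open>All durations are at least 1, so inserting 1 only matters if there is no control at all.\<close>
definition max_duration :: "('x, 'u) turbine \<Rightarrow> nat" where
  "max_duration M = Max (insert 1 (\<Union>x\<in>states M. duration M x ` controls M x))"


section \<open>Machine model\<close>

text \<open>
  Running times refer to a unit-cost random access machine.  Its memory consists of arrays of
  natural numbers and of arrays of costs (a scalar is entry 0 of an array), which a program
  accesses by array name and index.  Costs can be added and compared only.  Evaluating an
  expression takes one step per operator, array access or constant; assignments and tests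
  take one further step each.
\<close>

record memory =
  nats :: "string \<Rightarrow> nat \<Rightarrow> nat"
  costs :: "string \<Rightarrow> nat \<Rightarrow> ereal"

datatype nexp = Const nat | NGet string nexp | Plus nexp nexp | Minus nexp nexp

datatype cexp = Zero | CGet string nexp | CPlus cexp cexp

datatype bexp = NLess nexp nexp | CLess cexp cexp | Neg bexp | Conj bexp bexp

datatype com =
    Skip
  | NSet string nexp nexp
  | CSet string nexp cexp
  | Seq com com
  | Cond bexp com com
  | While bexp com

fun nval :: "nexp \<Rightarrow> memory \<Rightarrow> nat" where
  "nval (Const n) \<sigma> = n"
| "nval (NGet a i) \<sigma> = nats \<sigma> a (nval i \<sigma>)"
| "nval (Plus d e) \<sigma> = nval d \<sigma> + nval e \<sigma>"
| "nval (Minus d e) \<sigma> = nval d \<sigma> - nval e \<sigma>"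

fun cval :: "cexp \<Rightarrow> memory \<Rightarrow> ereal" where
  "cval Zero \<sigma> = 0"
| "cval (CGet a i) \<sigma> = costs \<sigma> a (nval i \<sigma>)"
| "cval (CPlus d e) \<sigma> = cval d \<sigma> + cval e \<sigma>"

fun bval :: "bexp \<Rightarrow> memory \<Rightarrow> bool" where
  "bval (NLess d e) \<sigma> \<longleftrightarrow> nval d \<sigma> < nval e \<sigma>"
| "bval (CLess d e) \<sigma> \<longleftrightarrow> cval d \<sigma> < cval e \<sigma>"
| "bval (Neg b) \<sigma> \<longleftrightarrow> \<not> bval b \<sigma>"
| "bval (Conj b c) \<sigma> \<longleftrightarrow> bval b \<sigma> \<and> bval c \<sigma>"

fun ntime :: "nexp \<Rightarrow> nat" where
  "ntime (Const n) = 1"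
| "ntime (NGet a i) = 1 + ntime i"
| "ntime (Plus d e) = 1 + ntime d + ntime e"
| "ntime (Minus d e) = 1 + ntime d + ntime e"

fun ctime :: "cexp \<Rightarrow> nat" where
  "ctime Zero = 1"
| "ctime (CGet a i) = 1 + ntime i"
| "ctime (CPlus d e) = 1 + ctime d + ctime e"

fun btime :: "bexp \<Rightarrow> nat" where
  "btime (NLess d e) = 1 + ntime d + ntime e"
| "btime (CLess d e) = 1 + ctime d + ctime e"
| "btime (Neg b) = 1 + btime b"
| "btime (Conj b c) = 1 + btime b + btime c"

definition nset :: "string \<Rightarrow> nat \<Rightarrow> nat \<Rightarrow> memory \<Rightarrow> memory" where
  "nset a i v \<sigma> = \<sigma>\<lparr>nats := (nats \<sigma>)(a := (nats \<sigma> a)(i := v))\<rparr>"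

definition cset :: "string \<Rightarrow> nat \<Rightarrow> ereal \<Rightarrow> memory \<Rightarrow> memory" where
  "cset a i v \<sigma> = \<sigma>\<lparr>costs := (costs \<sigma>)(a := (costs \<sigma> a)(i := v))\<rparr>"

text \<open>\<open>exec C \<sigma> n \<sigma>'\<close>: started in \<open>\<sigma>\<close>, the program \<open>C\<close> halts in \<open>\<sigma>'\<close> after \<open>n\<close> steps.\<close>
inductive exec :: "com \<Rightarrow> memory \<Rightarrow> nat \<Rightarrow> memory \<Rightarrow> bool" where
  Skip: "exec Skip \<sigma> 1 \<sigma>"
| NSet: "exec (NSet a i e) \<sigma> (1 + ntime i + ntime e) (nset a (nval i \<sigma>) (nval e \<sigma>) \<sigma>)"
| CSet: "exec (CSet a i e) \<sigma> (1 + ntime i + ctime e) (cset a (nval i \<sigma>) (cval e \<sigma>) \<sigma>)"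
| Seq: "exec C \<sigma>\<^sub>1 m \<sigma>\<^sub>2 \<Longrightarrow> exec D \<sigma>\<^sub>2 n \<sigma>\<^sub>3 \<Longrightarrow> exec (Seq C D) \<sigma>\<^sub>1 (m + n) \<sigma>\<^sub>3"
| CondTrue: "bval b \<sigma>\<^sub>1 \<Longrightarrow> exec C \<sigma>\<^sub>1 n \<sigma>\<^sub>2 \<Longrightarrow> exec (Cond b C D) \<sigma>\<^sub>1 (1 + btime b + n) \<sigma>\<^sub>2"
| CondFalse: "\<not> bval b \<sigma>\<^sub>1 \<Longrightarrow> exec D \<sigma>\<^sub>1 n \<sigma>\<^sub>2 \<Longrightarrow> exec (Cond b C D) \<sigma>\<^sub>1 (1 + btime b + n) \<sigma>\<^sub>2"
| WhileFalse: "\<not> bval b \<sigma> \<Longrightarrow> exec (While b C) \<sigma> (1 + btime b) \<sigma>"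
| WhileTrue: "bval b \<sigma>\<^sub>1 \<Longrightarrow> exec C \<sigma>\<^sub>1 m \<sigma>\<^sub>2 \<Longrightarrow> exec (While b C) \<sigma>\<^sub>2 n \<sigma>\<^sub>3 \<Longrightarrow>
    exec (While b C) \<sigma>\<^sub>1 (1 + btime b + m + n) \<sigma>\<^sub>3"

text \<open>
  The input is a weighted digraph as a list of arcs, in any order and for any numbering \<open>\<nu>\<close> of the
  vertices.  The remaining memory has arbitrary contents.
\<close>
definition encodes ::
  "('v, 'e) pre_digraph \<Rightarrow> ('e \<Rightarrow> ereal) \<Rightarrow> 'v \<Rightarrow> 'v \<Rightarrow> 'e list \<Rightarrow> ('v \<Rightarrow> nat) \<Rightarrow> memory \<Rightarrow> bool" where
  "encodes G w s q es \<nu> \<sigma> \<longleftrightarrow>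
     distinct es \<and> set es = arcs G \<and> bij_betw \<nu> (verts G) {..<card (verts G)} \<and>
     nats \<sigma> ''arcs'' 0 = length es \<and> nats \<sigma> ''source'' 0 = \<nu> s \<and> nats \<sigma> ''target'' 0 = \<nu> q \<and>
     (\<forall>i<length es. nats \<sigma> ''tail'' i = \<nu> (tail G (es ! i)) \<and>
        nats \<sigma> ''head'' i = \<nu> (head G (es ! i)) \<and>
        costs \<sigma> ''weight'' i = w (es ! i))"

text \<open>The output is the list of the indices of the arcs of a path, in order.\<close>
definition outputs :: "'e list \<Rightarrow> memory \<Rightarrow> 'e list \<Rightarrow> bool" where
  "outputs es \<sigma> p \<longleftrightarrow> nats \<sigma> ''length'' 0 = length p \<and>
     (\<forall>i<length p. nats \<sigma> ''path'' i < length es \<and> es ! nats \<sigma> ''path'' i = p ! i)"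

text \<open>
  The empty output signals that there is no path from the source to the terminal; such a path is
  never empty.
\<close>
definition solves_robust_dispatch_within ::
  "com \<Rightarrow> nat \<Rightarrow> ('x, 'u) turbine \<Rightarrow> (nat \<Rightarrow> real) \<Rightarrow> (nat \<Rightarrow> real) \<Rightarrow> (nat \<Rightarrow> real) \<Rightarrow> (nat \<Rightarrow> real) \<Rightarrow> bool"
  where
  "solves_robust_dispatch_within C k M P\<^sub>0 H\<^sub>0 \<Delta>P \<Delta>H \<longleftrightarrow>
     (\<forall>es \<nu> \<sigma>. encodes (dispatch_graph M) (arc_cost M (worst_profile (horizon M) P\<^sub>0 H\<^sub>0 \<Delta>P \<Delta>H))
                 Source Terminal es \<nu> \<sigma> \<longrightarrow>
        (\<exists>n \<sigma>' p. exec C \<sigma> n \<sigma>' \<and> n \<le> k \<and> outputs es \<sigma>' p \<and>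
           (if dispatch_paths M = {} then p = []
            else is_arg_min (robust_cost M (demand_box (horizon M) P\<^sub>0 H\<^sub>0 \<Delta>P \<Delta>H))
                   (\<lambda>p. p \<in> dispatch_paths M) p)))"

end

theory Submission
  imports Defs
begin

text \<open>
  Every arc cost is monotone in the demand, so on each path the demand box attains its maximal cost
  at its upper corner, the same profile for all paths
  (\<open>robust_cost_eq_worst_profile\<close>).  Hence the robust cost and the nominal cost at that corner
  are the same function on paths, and minimum and minimizers agree.

  The remaining problem is a shortest path problem in a graph in which every arc increases the time
  of its vertex.  In such a graph every walk is a path without repeated arcs (\<open>ranked_awalk\<close>),
  so optimal walks suffice, and they are found by relaxing the arcs in an order in which each arc
  comes after all arcs leaving its head.  The order is obtained by repeatedly removing arcs, as in
  Kahn's topological sort, with the out-degrees as counters (\<open>arc_queue_step\<close>,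
  \<open>arc_queue_complete\<close>).  Working from the terminal backwards makes the chosen path readable
  from the source in the right order.

  The time bound is in terms of the arcs, and the graph may have far more vertices than arcs: \<open>At t x\<close>
  is a vertex for all times, reachable or not.  The program therefore never enumerates vertices;
  it initializes only the memory cells that belong to an end of some arc, to the source or to the
  terminal.  Each of its six loops has a body without loops, so that its running time is bounded by a
  constant times the number of iterations (\<open>runs_While\<close>), and every loop makes at most
  twice as many iterations as there are arcs.

  The bound on the number of arcs holds because each transition is determined by its
  starting time, state and control (\<open>card_arcs_le\<close>).
\<close>

section \<open>Worst-case demand\<close>

lemma worst_profile_in_demand_box:
  assumes "error_bounds T \<Delta>P \<Delta>H"
  shows "worst_profile T P\<^sub>0 H\<^sub>0 \<Delta>P \<Delta>H \<in> demand_box T P\<^sub>0 H\<^sub>0 \<Delta>P \<Delta>H"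
  using assms by (auto simp: worst_profile_def demand_box_def profiles_def error_bounds_def)

text \<open>The worst profile is the upper corner of the box, so monotonicity applies arc by arc.\<close>
lemma path_cost_le_worst_profile:
  assumes "monotone_arc_costs M" "error_bounds (horizon M) \<Delta>P \<Delta>H" "set p \<subseteq> arcs (dispatch_graph M)"
    and "\<xi> \<in> demand_box (horizon M) P\<^sub>0 H\<^sub>0 \<Delta>P \<Delta>H"
  shows "path_cost M \<xi> p \<le> path_cost M (worst_profile (horizon M) P\<^sub>0 H\<^sub>0 \<Delta>P \<Delta>H) p"
proof -
  let ?\<xi> = "worst_profile (horizon M) P\<^sub>0 H\<^sub>0 \<Delta>P \<Delta>H"
  have in_profiles: "\<xi> \<in> profiles (horizon M)" "?\<xi> \<in> profiles (horizon M)"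
    using assms(4) worst_profile_in_demand_box[OF assms(2), of P\<^sub>0 H\<^sub>0] by (auto simp: demand_box_def)
  have "fst \<xi> t \<le> fst ?\<xi> t \<and> snd \<xi> t \<le> snd ?\<xi> t" if "t \<in> {1..horizon M}" for t
  proof -
    have "\<bar>fst \<xi> t - P\<^sub>0 t\<bar> \<le> \<Delta>P t" "\<bar>snd \<xi> t - H\<^sub>0 t\<bar> \<le> \<Delta>H t"
      using assms(4) that unfolding demand_box_def by auto
    then show ?thesis using that by (auto simp: worst_profile_def abs_le_iff)
  qed
  then show ?thesis
    using assms(1,3) in_profiles unfolding path_cost_def monotone_arc_costs_def
    by (intro sum_mono) blast
qed

lemma robust_cost_eq_worst_profile:
  assumes "monotone_arc_costs M" "error_bounds (horizon M) \<Delta>P \<Delta>H" "set p \<subseteq> arcs (dispatch_graph M)"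
  shows "robust_cost M (demand_box (horizon M) P\<^sub>0 H\<^sub>0 \<Delta>P \<Delta>H) p =
    path_cost M (worst_profile (horizon M) P\<^sub>0 H\<^sub>0 \<Delta>P \<Delta>H) p"
  unfolding robust_cost_def
  using path_cost_le_worst_profile[OF assms] worst_profile_in_demand_box[OF assms(2)]
  by (intro antisym SUP_least SUP_upper) auto


section \<open>Size and acyclicity of the time-expanded graph\<close>

lemma dispatch_paths_arcs: "p \<in> dispatch_paths M \<Longrightarrow> set p \<subseteq> arcs (dispatch_graph M)"
  by (simp add: dispatch_paths_def pre_digraph.apath_def pre_digraph.awalk_def)

lemma step_arcs_subset:
  "{Step t x u |t x u. 1 \<le> t \<and> t + duration M x u \<le> horizon M \<and> x \<in> states M \<and> u \<in> controls M x} \<subseteq>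
    (\<lambda>(t, x, u). Step t x u) ` ({1..horizon M} \<times> (SIGMA x:states M. controls M x))"
  by (force simp: image_def)

lemma fin_digraph_dispatch_graph:
  assumes "turbine_model M"
  shows "fin_digraph (dispatch_graph M)"
proof
  fix e assume "e \<in> arcs (dispatch_graph M)"
  then show "tail (dispatch_graph M) e \<in> verts (dispatch_graph M)"
    and "head (dispatch_graph M) e \<in> verts (dispatch_graph M)"
    using assms by (auto simp: dispatch_graph_def turbine_model_def)
next
  have "{At t x |t x. t \<in> {1..horizon M} \<and> x \<in> states M} =
      (\<lambda>(t, x). At t x) ` ({1..horizon M} \<times> states M)"
    by auto
  then show "finite (verts (dispatch_graph M))"
    using assms by (simp add: dispatch_graph_def turbine_model_def)
  show "finite (arcs (dispatch_graph M))"
    using assms finite_subset[OF step_arcs_subset, of M]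
    by (auto simp: dispatch_graph_def turbine_model_def)
qed

lemma card_states_le_card_arcs:
  fixes M :: "('x, 'u) turbine"
  assumes "turbine_model M"
  shows "card (states M) \<le> card (arcs (dispatch_graph M))"
proof -
  have "card (states M) = card (Start ` states M :: ('x, 'u) arc set)"
    by (simp add: card_image inj_on_def)
  also have "\<dots> \<le> card (arcs (dispatch_graph M))"
    using fin_digraph.finite_arcs[OF fin_digraph_dispatch_graph[OF assms]]
    by (intro card_mono) (auto simp: dispatch_graph_def)
  finally show ?thesis .
qed

text \<open>
  Start and stop arcs contribute two arcs per state; as \<open>max_duration M\<close> and the horizon are
  at least 1, this is at most twice the product on the right, whence the factor \<open>m + 2\<close>.
\<close>
lemma card_arcs_le:
  fixes M :: "('x, 'u) turbine"
  assumes "turbine_model M" "\<forall>x\<in>states M. card (controls M x) \<le> m * max_duration M"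
  shows "card (arcs (dispatch_graph M)) \<le> (m + 2) * (max_duration M * card (states M) * horizon M)"
proof -
  let ?S = "{Step t x u |t x u. 1 \<le> t \<and> t + duration M x u \<le> horizon M \<and> x \<in> states M \<and> u \<in> controls M x}"
  have fin: "finite (states M)" "\<And>x. x \<in> states M \<Longrightarrow> finite (controls M x)" "1 \<le> horizon M"
    using assms(1) by (auto simp: turbine_model_def)
  have "1 \<le> max_duration M"
    unfolding max_duration_def using fin by (intro Max_ge) auto
  with fin(3) have "1 \<le> max_duration M * horizon M" by simp
  then have states_le: "card (states M) \<le> max_duration M * card (states M) * horizon M"
    by (simp add: algebra_simps)
  have "card ?S \<le> card ({1..horizon M} \<times> (SIGMA x:states M. controls M x))"
    using fin by (intro surj_card_le[OF _ step_arcs_subset]) auto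
  also have "\<dots> = horizon M * (\<Sum>x\<in>states M. card (controls M x))"
    using fin by (simp add: card_cartesian_product)
  also have "\<dots> \<le> horizon M * (card (states M) * (m * max_duration M))"
    using sum_bounded_above[of "states M" "\<lambda>x. card (controls M x)" "m * max_duration M"] assms(2)
    by simp
  finally have steps: "card ?S \<le> m * (max_duration M * card (states M) * horizon M)"
    by (simp add: algebra_simps)
  have "card (arcs (dispatch_graph M)) \<le> card (Start ` states M \<union> Stop ` states M :: ('x, 'u) arc set) + card ?S"
    unfolding dispatch_graph_def by (simp add: card_Un_le)
  also have "card (Start ` states M \<union> Stop ` states M :: ('x, 'u) arc set) \<le> card (states M) + card (states M)"
    using card_image_le[OF fin(1)] by (intro order_trans[OF card_Un_le] add_mono)
  finally show ?thesis using steps states_le unfolding add_mult_distrib by linarith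
qed

text \<open>A potential that every arc increases because durations are positive; it witnesses acyclicity.\<close>
fun vertex_time :: "nat \<Rightarrow> 'x vertex \<Rightarrow> nat" where
  "vertex_time T Source = 0"
| "vertex_time T (At t x) = t"
| "vertex_time T Terminal = Suc T"

lemma vertex_time_less:
  assumes "turbine_model M" "e \<in> arcs (dispatch_graph M)"
  shows "vertex_time (horizon M) (tail (dispatch_graph M) e) < vertex_time (horizon M) (head (dispatch_graph M) e)"
  using assms by (force simp: dispatch_graph_def turbine_model_def)

text \<open>
  A potential increases strictly along a walk, so a walk cannot return to a vertex or an arc.
\<close>
lemma ranked_awalk:
  assumes "\<And>e. e \<in> arcs G \<Longrightarrow> rank (tail G e) < (rank (head G e) :: nat)"
    and "pre_digraph.awalk G u p v"
  shows "pre_digraph.apath G u p v" and "distinct p"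
proof -
  \<comment> \<open>The two bounds from below by \<open>rank u\<close> are what the induction needs to see that a new first vertex and arc are fresh.\<close>
  have "(\<forall>w\<in>set (pre_digraph.awalk_verts G u p). rank u \<le> rank w) \<and> (\<forall>e\<in>set p. rank u \<le> rank (tail G e)) \<and>
      distinct (pre_digraph.awalk_verts G u p) \<and> distinct p"
    if "set p \<subseteq> arcs G" "pre_digraph.cas G u p v" for u
    using that
  proof (induction p arbitrary: u)
    case Nil
    then show ?case by (simp add: pre_digraph.awalk_verts.simps)
  next
    case (Cons e p)
    then have "e \<in> arcs G" "tail G e = u" and IH:
      "(\<forall>w\<in>set (pre_digraph.awalk_verts G (head G e) p). rank (head G e) \<le> rank w)"
      "\<forall>e'\<in>set p. rank (head G e) \<le> rank (tail G e')"
      "distinct (pre_digraph.awalk_verts G (head G e) p)" "distinct p"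
      by (auto simp: pre_digraph.cas.simps)
    with assms(1)[of e] show ?case
      by (fastforce simp: pre_digraph.awalk_verts.simps)
  qed
  with assms(2) show "pre_digraph.apath G u p v" "distinct p"
    by (auto simp: pre_digraph.apath_def pre_digraph.awalk_def)
qed

section \<open>Running time of programs\<close>

text \<open>Total correctness with a time bound.\<close>
definition runs :: "com \<Rightarrow> memory \<Rightarrow> nat \<Rightarrow> (memory \<Rightarrow> bool) \<Rightarrow> bool" where
  "runs C \<sigma> k Q \<longleftrightarrow> (\<exists>n \<sigma>'. exec C \<sigma> n \<sigma>' \<and> n \<le> k \<and> Q \<sigma>')"

text \<open>
  Without loops, a program has a total denotation \<open>effect\<close> and a running time bound
  \<open>max_steps\<close> that depends only on its text.  Both can be computed by rewriting, which reduces
  reasoning about loop bodies to simplification.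
\<close>
fun loop_free :: "com \<Rightarrow> bool" where
  "loop_free (Seq C D) \<longleftrightarrow> loop_free C \<and> loop_free D"
| "loop_free (Cond b C D) \<longleftrightarrow> loop_free C \<and> loop_free D"
| "loop_free (While b C) \<longleftrightarrow> False"
| "loop_free _ \<longleftrightarrow> True"

text \<open>The value on a loop is a default; \<open>effect\<close> is meaningful for loop-free programs.\<close>
fun effect :: "com \<Rightarrow> memory \<Rightarrow> memory" where
  "effect (NSet a i e) \<sigma> = nset a (nval i \<sigma>) (nval e \<sigma>) \<sigma>"
| "effect (CSet a i e) \<sigma> = cset a (nval i \<sigma>) (cval e \<sigma>) \<sigma>"
| "effect (Seq C D) \<sigma> = effect D (effect C \<sigma>)"
| "effect (Cond b C D) \<sigma> = (if bval b \<sigma> then effect C \<sigma> else effect D \<sigma>)"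
| "effect _ \<sigma> = \<sigma>"

fun max_steps :: "com \<Rightarrow> nat" where
  "max_steps (NSet a i e) = 1 + ntime i + ntime e"
| "max_steps (CSet a i e) = 1 + ntime i + ctime e"
| "max_steps (Seq C D) = max_steps C + max_steps D"
| "max_steps (Cond b C D) = 1 + btime b + max (max_steps C) (max_steps D)"
| "max_steps _ = 1"

lemma exec_loop_free: "loop_free C \<Longrightarrow> \<exists>n\<le>max_steps C. exec C \<sigma> n (effect C \<sigma>)"
proof (induction C arbitrary: \<sigma>)
  case (Seq C D)
  then obtain m n where "m \<le> max_steps C" "exec C \<sigma> m (effect C \<sigma>)"
    "n \<le> max_steps D" "exec D (effect C \<sigma>) n (effect D (effect C \<sigma>))"
    by fastforce
  then show ?case by (auto intro!: exI[of _ "m + n"] exec.Seq)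
next
  case (Cond b C D)
  then obtain m n where "m \<le> max_steps C" "exec C \<sigma> m (effect C \<sigma>)"
    "n \<le> max_steps D" "exec D \<sigma> n (effect D \<sigma>)"
    by fastforce
  then show ?case
    by (auto intro!: exI[of _ "1 + btime b + (if bval b \<sigma> then m else n)"]
        intro: exec.CondTrue[simplified] exec.CondFalse[simplified])
qed (auto intro: exec.intros[simplified] simp: exec.Skip exec.NSet[simplified] exec.CSet[simplified])

lemma runs_loop_free: "loop_free C \<Longrightarrow> Q (effect C \<sigma>) \<Longrightarrow> runs C \<sigma> (max_steps C) Q"
  unfolding runs_def using exec_loop_free[of C \<sigma>] by blast

lemma runs_Seq:
  assumes "runs C \<sigma> k R" "\<And>\<sigma>'. R \<sigma>' \<Longrightarrow> runs D \<sigma>' l Q"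
  shows "runs (Seq C D) \<sigma> (k + l) Q"
proof -
  obtain m \<sigma>' where "exec C \<sigma> m \<sigma>'" "m \<le> k" "R \<sigma>'"
    using assms(1) by (auto simp: runs_def)
  moreover obtain n \<sigma>'' where "exec D \<sigma>' n \<sigma>''" "n \<le> l" "Q \<sigma>''"
    using assms(2)[OF \<open>R \<sigma>'\<close>] by (auto simp: runs_def)
  ultimately show ?thesis
    unfolding runs_def by (meson add_mono exec.Seq)
qed

lemma runs_mono: "runs C \<sigma> k R \<Longrightarrow> k \<le> l \<Longrightarrow> (\<And>\<sigma>'. R \<sigma>' \<Longrightarrow> Q \<sigma>') \<Longrightarrow> runs C \<sigma> l Q"
  unfolding runs_def by (meson le_trans)

definition iteration_steps :: "bexp \<Rightarrow> com \<Rightarrow> nat" where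
  "iteration_steps b C = 1 + btime b + max_steps C"

text \<open>
  A variant that starts at most at \<open>k\<close> allows \<open>k\<close> iterations; the additional one in
  \<open>Suc k\<close> pays for the final test.
\<close>
lemma runs_While:
  assumes "loop_free C" "I \<sigma>"
    and step: "\<And>\<sigma>. I \<sigma> \<Longrightarrow> bval b \<sigma> \<Longrightarrow> I (effect C \<sigma>) \<and> var (effect C \<sigma>) < (var \<sigma> :: nat)"
    and "var \<sigma> \<le> k"
  shows "runs (While b C) \<sigma> (Suc k * iteration_steps b C) (\<lambda>\<sigma>. I \<sigma> \<and> \<not> bval b \<sigma>)"
  using assms(2,4)
proof (induction k arbitrary: \<sigma>)
  case 0
  then have "\<not> bval b \<sigma>" using step[of \<sigma>] by auto
  with 0 show ?case
    unfolding runs_def iteration_steps_def using exec.WhileFalse[of b \<sigma> C] by fastforce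
next
  case (Suc k)
  show ?case
  proof (cases "bval b \<sigma>")
    case True
    with step[OF Suc.prems(1)] Suc.prems(2) have "I (effect C \<sigma>)" "var (effect C \<sigma>) \<le> k" by auto
    from Suc.IH[OF this] obtain n \<sigma>' where n: "exec (While b C) (effect C \<sigma>) n \<sigma>'"
      "n \<le> Suc k * iteration_steps b C" "I \<sigma>'" "\<not> bval b \<sigma>'"
      by (auto simp: runs_def)
    obtain m where m: "m \<le> max_steps C" "exec C \<sigma> m (effect C \<sigma>)"
      using exec_loop_free[OF assms(1)] by blast
    have "1 + btime b + m + n \<le> Suc (Suc k) * iteration_steps b C"
      using m(1) n(2) by (simp add: iteration_steps_def)
    then show ?thesis
      using exec.WhileTrue[OF True m(2) n(1)] n(3,4) unfolding runs_def by blast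
  next
    case False
    then show ?thesis
      using Suc.prems exec.WhileFalse[of b \<sigma> C]
      unfolding runs_def iteration_steps_def by fastforce
  qed
qed

text \<open>The shape of all parts of the program below: an initialization followed by one loop.\<close>
lemma runs_phase:
  assumes "loop_free A" "loop_free C" "I (effect A \<sigma>)"
    and "\<And>\<sigma>. I \<sigma> \<Longrightarrow> bval b \<sigma> \<Longrightarrow> I (effect C \<sigma>) \<and> var (effect C \<sigma>) < (var \<sigma> :: nat)"
    and "var (effect A \<sigma>) \<le> k" and "\<And>\<sigma>. I \<sigma> \<Longrightarrow> \<not> bval b \<sigma> \<Longrightarrow> Q \<sigma>"
  shows "runs (Seq A (While b C)) \<sigma> (max_steps A + Suc k * iteration_steps b C) Q"
proof (rule runs_Seq)
  show "runs A \<sigma> (max_steps A) (\<lambda>\<sigma>'. \<sigma>' = effect A \<sigma>)"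
    using assms(1) by (rule runs_loop_free) simp
next
  fix \<sigma>' assume "\<sigma>' = effect A \<sigma>"
  then have "runs (While b C) \<sigma>' (Suc k * iteration_steps b C) (\<lambda>\<sigma>. I \<sigma> \<and> \<not> bval b \<sigma>)"
    using assms(2-5) by (intro runs_While[where var = var]) auto
  then show "runs (While b C) \<sigma>' (Suc k * iteration_steps b C) Q"
    using assms(6) by (blast intro: runs_mono)
qed

lemma nats_nset [simp]: "nats (nset a i v \<sigma>) = (nats \<sigma>)(a := (nats \<sigma> a)(i := v))"
  and costs_nset [simp]: "costs (nset a i v \<sigma>) = costs \<sigma>"
  and nats_cset [simp]: "nats (cset a i c \<sigma>) = nats \<sigma>"
  and costs_cset [simp]: "costs (cset a i c \<sigma>) = (costs \<sigma>)(a := (costs \<sigma> a)(i := c))"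
  by (simp_all add: nset_def cset_def)


section \<open>The program\<close>

abbreviation nvar :: "string \<Rightarrow> nexp" where
  "nvar a \<equiv> NGet a (Const 0)"

abbreviation nassign :: "string \<Rightarrow> nexp \<Rightarrow> com" where
  "nassign a e \<equiv> NSet a (Const 0) e"

abbreviation succ :: "nexp \<Rightarrow> nexp" where
  "succ e \<equiv> Plus e (Const 1)"

abbreviation incr :: "string \<Rightarrow> com" where
  "incr a \<equiv> nassign a (succ (nvar a))"

abbreviation block :: "com list \<Rightarrow> com" where
  "block Cs \<equiv> foldr Seq Cs Skip"

text \<open>
  The program keeps the following arrays.  For a vertex \<open>v\<close>, \<open>outdeg\<close> counts the arcs
  out of \<open>v\<close> that have not been processed by the sorting loop, and \<open>first\<close> is the start
  of a linked list of the arcs into \<open>v\<close>, continued by \<open>next\<close>; list pointers are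
  shifted by one so that 0 is the end.  The arcs are sorted into \<open>order\<close>.  The cost of the
  best known path from \<open>v\<close> to the terminal is \<open>dist\<close>, and \<open>best\<close> is
  its first arc.  As there is no constant for infinite costs, and a path may be infinitely expensive,
  unreached vertices cannot be marked by \<open>dist\<close>.  Instead two values beyond the
  arc indices mark special vertices in \<open>best\<close>: the number of arcs marks the terminal, and
  its successor marks the unreached vertices.
\<close>
definition more_arcs :: bexp where
  "more_arcs = NLess (nvar ''i'') (nvar ''arcs'')"

definition clear_body :: com where
  "clear_body =
    (let t = NGet ''tail'' (nvar ''i''); h = NGet ''head'' (nvar ''i'') in block
      [NSet ''outdeg'' t (Const 0), NSet ''outdeg'' h (Const 0),
       NSet ''first'' t (Const 0), NSet ''first'' h (Const 0),
       NSet ''best'' t (succ (nvar ''arcs'')), NSet ''best'' h (succ (nvar ''arcs'')),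
       incr ''i''])"

definition link_body :: com where
  "link_body =
    (let t = NGet ''tail'' (nvar ''i''); h = NGet ''head'' (nvar ''i'') in block
      [NSet ''outdeg'' t (succ (NGet ''outdeg'' t)),
       NSet ''next'' (nvar ''i'') (NGet ''first'' h),
       NSet ''first'' h (succ (nvar ''i'')),
       incr ''i''])"

definition seed_body :: com where
  "seed_body = block
    [Cond (NLess (NGet ''outdeg'' (NGet ''head'' (nvar ''i''))) (Const 1))
       (block [NSet ''order'' (nvar ''n'') (nvar ''i''), incr ''n'']) Skip,
     incr ''i'']"

text \<open>
  Sorting is by nature a nested loop: processing an arc may release a whole list of arcs.  It is
  flattened by keeping the rest of that list in \<open>pending\<close>; one iteration either appends one
  pending arc or, if there is none, processes the next arc of the queue.  The test succeeds if one of the two is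
  possible, since \<open>j\<close> never exceeds \<open>n\<close>.
\<close>
definition sort_test :: bexp where
  "sort_test = NLess (nvar ''j'') (Plus (nvar ''n'') (nvar ''pending''))"

definition sort_body :: com where
  "sort_body =
    (let v = NGet ''tail'' (NGet ''order'' (nvar ''j'')) in
     Cond (NLess (Const 0) (nvar ''pending''))
      (block
        [nassign ''pending'' (Minus (nvar ''pending'') (Const 1)),
         NSet ''order'' (nvar ''n'') (nvar ''pending''),
         incr ''n'',
         nassign ''pending'' (NGet ''next'' (nvar ''pending''))])
      (block
        [NSet ''outdeg'' v (Minus (NGet ''outdeg'' v) (Const 1)),
         Cond (NLess (NGet ''outdeg'' v) (Const 1)) (nassign ''pending'' (NGet ''first'' v)) Skip,
         incr ''j'']))"

text \<open>
  The condition is a disjunction written with negation: the tail is unreached, or its known cost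
  improves.
\<close>
definition relax_body :: com where
  "relax_body =
    (let e = NGet ''order'' (nvar ''i''); t = NGet ''tail'' e; h = NGet ''head'' e;
         d = CPlus (CGet ''weight'' e) (CGet ''dist'' h); unreached = succ (nvar ''arcs'') in block
      [Cond (Conj (NLess (NGet ''best'' h) unreached)
              (Neg (Conj (NLess (NGet ''best'' t) unreached) (Neg (CLess d (CGet ''dist'' t))))))
        (block [CSet ''dist'' t d, NSet ''best'' t e]) Skip,
       incr ''i''])"

definition trace_test :: bexp where
  "trace_test = NLess (NGet ''best'' (nvar ''v'')) (nvar ''arcs'')"

text \<open>
  If the source is unreached, then the loop stops at once and leaves the empty path, as required.
\<close>
definition trace_body :: com where
  "trace_body = block
    [NSet ''path'' (nvar ''length'') (NGet ''best'' (nvar ''v'')),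
     incr ''length'',
     nassign ''v'' (NGet ''head'' (NGet ''best'' (nvar ''v'')))]"

definition clear_phase :: com where
  "clear_phase = Seq
    (block [nassign ''i'' (Const 0), NSet ''best'' (nvar ''source'') (succ (nvar ''arcs''))])
    (While more_arcs clear_body)"

definition link_phase :: com where
  "link_phase = Seq (nassign ''i'' (Const 0)) (While more_arcs link_body)"

definition seed_phase :: com where
  "seed_phase = Seq
    (block [nassign ''i'' (Const 0), nassign ''n'' (Const 0)]) (While more_arcs seed_body)"

definition sort_phase :: com where
  "sort_phase = Seq
    (block [nassign ''j'' (Const 0), nassign ''pending'' (Const 0)]) (While sort_test sort_body)"

definition relax_phase :: com where
  "relax_phase = Seq
    (block [nassign ''i'' (Const 0), NSet ''best'' (nvar ''target'') (nvar ''arcs''),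
      CSet ''dist'' (nvar ''target'') Zero])
    (While more_arcs relax_body)"

definition trace_phase :: com where
  "trace_phase = Seq
    (block [nassign ''length'' (Const 0), nassign ''v'' (nvar ''source'')])
    (While trace_test trace_body)"

definition shortest_path_program :: com where
  "shortest_path_program =
    Seq clear_phase (Seq link_phase (Seq seed_phase (Seq sort_phase (Seq relax_phase trace_phase))))"

section \<open>Topological sorting of arcs\<close>

text \<open>
  The graph as the program sees it: arcs are indices below \<open>m\<close>, vertices are numbers.
  The potential \<open>rank\<close> expresses acyclicity and does not occur in the program.
\<close>
locale ranked_arcs =
  fixes m :: nat and org dst :: "nat \<Rightarrow> nat" and rank :: "nat \<Rightarrow> nat"
  assumes rank_less: "i < m \<Longrightarrow> rank (org i) < rank (dst i)"
begin

definition out :: "nat \<Rightarrow> nat set" where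
  "out v = {i. i < m \<and> org i = v}"

text \<open>The order in which the linked lists of the program hold the arcs: newest first.\<close>
definition arcs_into :: "nat \<Rightarrow> nat \<Rightarrow> nat list" where
  "arcs_into n v = rev (filter (\<lambda>i. dst i = v) [0..<n])"

text \<open>
  The state of the sort after processing the first \<open>j\<close> arcs of the queue \<open>L\<close>.  An arc
  is in the queue as soon as all arcs out of its head have been processed, and no earlier; moreover
  each arc comes after those arcs.
\<close>
definition arc_queue :: "nat \<Rightarrow> nat list \<Rightarrow> bool" where
  "arc_queue j L \<longleftrightarrow> distinct L \<and> set L = {i. i < m \<and> out (dst i) \<subseteq> set (take j L)} \<and>
     (\<forall>a<length L. out (dst (L ! a)) \<subseteq> set (take a L))"

lemma finite_out [simp]: "finite (out v)"
  by (simp add: out_def)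

lemma arc_queue_length:
  assumes "arc_queue j L"
  shows "length L \<le> m"
proof -
  have "distinct L" "set L \<subseteq> {..<m}" using assms unfolding arc_queue_def by blast+
  then show ?thesis using card_mono[of "{..<m}" "set L"] by (simp add: distinct_card)
qed

text \<open>
  Processing \<open>L ! j\<close> can only release arcs into its tail \<open>v\<close>.  These arcs are all
  missing from the queue before, because \<open>L ! j\<close> itself was an unprocessed arc out of
  \<open>v\<close>; and they are all released at the moment when the last arc out of \<open>v\<close> is
  processed.
\<close>
lemma arc_queue_step:
  assumes "arc_queue j L" "j < length L"
  defines "v \<equiv> org (L ! j)"
  shows "arc_queue (Suc j) (L @ (if out v \<subseteq> set (take (Suc j) L) then arcs_into m v else []))"
    (is "arc_queue _ (L @ ?X)")
proof -
  let ?T = "set (take j L)"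
  have dist: "distinct L" and L: "set L = {i. i < m \<and> out (dst i) \<subseteq> ?T}"
    and topo: "\<And>a. a < length L \<Longrightarrow> out (dst (L ! a)) \<subseteq> set (take a L)"
    using assms(1) by (auto simp: arc_queue_def)
  have T: "set (take (Suc j) L) = insert (L ! j) ?T"
    using assms(2) by (simp add: take_Suc_conv_app_nth)
  have "L ! j \<in> set L" using assms(2) by simp
  then have j: "L ! j \<in> out v" using L by (auto simp: out_def v_def)
  have "L ! j \<notin> ?T"
    using dist assms(2) by (auto simp: in_set_conv_nth nth_eq_iff_index_eq)
  with j L have fresh: "dst i \<noteq> v" if "i \<in> set L" for i
    using that by auto
  have X: "set ?X = {i. i < m \<and> dst i = v \<and> out v \<subseteq> set (take (Suc j) L)}"
    by (auto simp: arcs_into_def)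
  have "distinct (L @ ?X)"
    using dist fresh by (auto simp: arcs_into_def)
  moreover have "set (L @ ?X) = {i. i < m \<and> out (dst i) \<subseteq> set (take (Suc j) L)}"
  proof -
    have "L ! j \<in> out (dst i) \<Longrightarrow> dst i = v" for i
      by (simp add: out_def v_def)
    then have "out (dst i) \<subseteq> set (take (Suc j) L) \<longleftrightarrow>
        out (dst i) \<subseteq> ?T \<or> dst i = v \<and> out v \<subseteq> set (take (Suc j) L)" for i
      unfolding T by auto
    then show ?thesis unfolding set_append X L by auto
  qed
  moreover have "set (take (Suc j) (L @ ?X)) = set (take (Suc j) L)"
    using assms(2) by simp
  moreover have "out (dst ((L @ ?X) ! a)) \<subseteq> set (take a (L @ ?X))" if "a < length (L @ ?X)" for a
  proof (cases "a < length L")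
    case True
    then show ?thesis using topo by (simp add: nth_append)
  next
    case False
    then have "(L @ ?X) ! a \<in> set ?X"
      using that by (simp only: nth_append if_False) (intro nth_mem, simp)
    then have "out (dst ((L @ ?X) ! a)) \<subseteq> set (take (Suc j) L)"
      using X by auto
    also have "\<dots> \<subseteq> set (take a (L @ ?X))"
      using False assms(2) by (auto dest: in_set_takeD)
    finally show ?thesis .
  qed
  ultimately show ?thesis by (simp add: arc_queue_def)
qed

text \<open>
  If some arc never entered the queue, take one whose tail has the largest rank.  All arcs out of its
  head have a tail of larger rank, so they were processed, and the arc should have been released.
\<close>
lemma arc_queue_complete:
  assumes "arc_queue (length L) L"
  shows "set L = {..<m}"
proof (rule ccontr)
  have closed: "i \<in> set L" if "i < m" "out (dst i) \<subseteq> set L" for i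
    using assms that unfolding arc_queue_def take_all[OF order_refl] by blast
  assume "set L \<noteq> {..<m}"
  moreover have "set L \<subseteq> {..<m}" using assms unfolding arc_queue_def by blast
  ultimately have "{..<m} - set L \<noteq> {}" by blast
  from ex_is_arg_min_if_finite[OF _ this, of "\<lambda>i. - int (rank (org i))"]
  obtain i where min: "is_arg_min (\<lambda>i. - int (rank (org i))) (\<lambda>i. i \<in> {..<m} - set L) i"
    by auto
  then have i: "i < m" "i \<notin> set L" by (auto simp: is_arg_min_def)
  have "out (dst i) \<subseteq> set L"
  proof
    fix k assume "k \<in> out (dst i)"
    then have k: "k < m" "rank (org i) < rank (org k)"
      using rank_less[OF i(1)] by (auto simp: out_def)
    then show "k \<in> set L"
      using min by (auto simp: is_arg_min_def)
  qed
  with i closed show False by blast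
qed

definition arc_order :: "nat list \<Rightarrow> bool" where
  "arc_order L \<longleftrightarrow> distinct L \<and> set L = {..<m} \<and>
     (\<forall>a<length L. out (dst (L ! a)) \<subseteq> set (take a L))"

lemma arc_queue_arc_order: "arc_queue (length L) L \<Longrightarrow> arc_order L"
  using arc_queue_complete unfolding arc_queue_def arc_order_def by blast

lemma arc_order_length: "arc_order L \<Longrightarrow> length L = m"
  unfolding arc_order_def by (metis card_lessThan distinct_card)

end


section \<open>Relaxation and optimal walks\<close>

context ranked_arcs
begin

fun walk :: "nat \<Rightarrow> nat list \<Rightarrow> nat \<Rightarrow> bool" where
  "walk u [] v \<longleftrightarrow> u = v"
| "walk u (i # p) v \<longleftrightarrow> i < m \<and> org i = u \<and> walk (dst i) p v"

lemma walk_append: "walk u (p @ r) w \<longleftrightarrow> (\<exists>v. walk u p v \<and> walk v r w)"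
  by (induction p arbitrary: u) auto

definition vertices :: "nat \<Rightarrow> nat \<Rightarrow> nat set" where
  "vertices s q = insert s (insert q (org ` {..<m} \<union> dst ` {..<m}))"

definition cost :: "(nat \<Rightarrow> ereal) \<Rightarrow> nat list \<Rightarrow> ereal" where
  "cost w p = sum_list (map w p)"

text \<open>
  The two halves of correctness of the tables \<open>B\<close> (best arcs) and \<open>D\<close> (costs) after
  relaxing the arcs in \<open>S\<close>, for target \<open>q\<close>.  The first: no walk to \<open>q\<close> that
  starts with an arc in \<open>S\<close> is missed or cheaper than its table entry.
\<close>
definition lower_bounds :: "(nat \<Rightarrow> ereal) \<Rightarrow> nat \<Rightarrow> nat set \<Rightarrow> (nat \<Rightarrow> nat) \<Rightarrow> (nat \<Rightarrow> ereal) \<Rightarrow> bool" where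
  "lower_bounds w q S B D \<longleftrightarrow>
     (\<forall>v p. walk v p q \<and> (p \<noteq> [] \<longrightarrow> hd p \<in> S) \<longrightarrow> B v \<le> m \<and> D v \<le> cost w p)"

text \<open>
  The second: table entries are attained by following best arcs.  The bound on ranks serves to show
  that the entry of \<open>q\<close> is never overwritten: an arc from \<open>q\<close> leads to a rank above
  that of \<open>q\<close>, hence to an unreached vertex.  The restriction to \<open>vertices s q\<close> is
  due to the arbitrary contents of all other table entries.
\<close>
definition best_arcs :: "(nat \<Rightarrow> ereal) \<Rightarrow> nat \<Rightarrow> nat \<Rightarrow> nat set \<Rightarrow> (nat \<Rightarrow> nat) \<Rightarrow> (nat \<Rightarrow> ereal) \<Rightarrow> bool" where
  "best_arcs w s q S B D \<longleftrightarrow>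
     (\<forall>v\<in>vertices s q. B v \<le> m \<longrightarrow> rank v \<le> rank q \<and>
        (v = q \<and> B v = m \<and> D v = 0 \<or>
         B v \<in> S \<and> org (B v) = v \<and> B (dst (B v)) \<le> m \<and> D v = w (B v) + D (dst (B v))))"

text \<open>
  When \<open>e\<close> is relaxed, all arcs out of its head have been relaxed, so the entry of the head
  accounts for all walks from there.  Conversely no relaxed arc leads into the tail of
  \<open>e\<close>, since otherwise \<open>e\<close> would have been relaxed before it; therefore changing the entry of the
  tail does not invalidate an equation between entries established earlier.
\<close>
lemma relax_step:
  assumes S: "S \<subseteq> {..<m}" "\<And>i. i \<in> S \<Longrightarrow> out (dst i) \<subseteq> S"
    and e: "e < m" "e \<notin> S" "out (dst e) \<subseteq> S"
    and lower: "lower_bounds w q S B D" and best: "best_arcs w s q S B D"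
  defines "improves \<equiv> B (dst e) \<le> m \<and> (B (org e) \<le> m \<longrightarrow> w e + D (dst e) < D (org e))"
  defines "B' \<equiv> if improves then B(org e := e) else B"
    and "D' \<equiv> if improves then D(org e := w e + D (dst e)) else D"
  shows "lower_bounds w q (insert e S) B' D'" "best_arcs w s q (insert e S) B' D'"
proof -
  have ends: "org e \<in> vertices s q" "dst e \<in> vertices s q" using e(1) by (auto simp: vertices_def)
  have noloop: "dst e \<noteq> org e" using rank_less[OF e(1)] by auto
  have le: "B v \<le> m \<Longrightarrow> B' v \<le> m \<and> D' v \<le> D v" for v
    using e(1) by (auto simp: B'_def D'_def improves_def)
  have relaxed: "B' (org e) \<le> m \<and> D' (org e) \<le> w e + D (dst e)" if "B (dst e) \<le> m"
    using that e(1) by (auto simp: B'_def D'_def improves_def)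
  show "lower_bounds w q (insert e S) B' D'"
    unfolding lower_bounds_def
  proof (intro allI impI, elim conjE)
    fix v p assume p: "walk v p q" "p \<noteq> [] \<longrightarrow> hd p \<in> insert e S"
    show "B' v \<le> m \<and> D' v \<le> cost w p"
    proof (cases "p \<noteq> [] \<and> hd p = e")
      case True
      then obtain r where r: "p = e # r" by (cases p) auto
      with p have v: "v = org e" and walk: "walk (dst e) r q" by auto
      have "r \<noteq> [] \<longrightarrow> hd r \<in> S"
        using walk e(3) by (cases r) (auto simp: out_def)
      with walk lower have "B (dst e) \<le> m" "D (dst e) \<le> cost w r"
        by (auto simp: lower_bounds_def)
      then show ?thesis
        using relaxed add_left_mono[of "D (dst e)" "cost w r" "w e"]
        by (auto simp: v r cost_def intro: order_trans)
    next
      case False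
      with p lower have "B v \<le> m" "D v \<le> cost w p" by (auto simp: lower_bounds_def)
      with le show ?thesis by (meson order_trans)
    qed
  qed
  show "best_arcs w s q (insert e S) B' D'"
  proof (cases improves)
    case improves: True
    then have "rank (org e) < rank q"
      using best ends(2) rank_less[OF e(1)] unfolding best_arcs_def improves_def
      by (blast intro: less_le_trans)
    have B': "B' = B(org e := e)" and D': "D' = D(org e := w e + D (dst e))"
      using improves by (simp_all add: B'_def D'_def)
    have unchanged: "dst i \<noteq> org e" if "i \<in> S" for i
      using S(2)[OF that] e(1,2) by (auto simp: out_def)
    show ?thesis
      unfolding best_arcs_def
    proof (intro ballI impI)
      fix v assume v: "v \<in> vertices s q" "B' v \<le> m"
      show "rank v \<le> rank q \<and> (v = q \<and> B' v = m \<and> D' v = 0 \<or>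
         B' v \<in> insert e S \<and> org (B' v) = v \<and> B' (dst (B' v)) \<le> m \<and> D' v = w (B' v) + D' (dst (B' v)))"
      proof (cases "v = org e")
        case True
        then show ?thesis
          using improves noloop \<open>rank (org e) < rank q\<close> by (auto simp: B' D' improves_def)
      next
        case False
        with v best have "rank v \<le> rank q" "v = q \<and> B v = m \<and> D v = 0 \<or>
           B v \<in> S \<and> org (B v) = v \<and> B (dst (B v)) \<le> m \<and> D v = w (B v) + D (dst (B v))"
          by (auto simp: B' best_arcs_def)
        then show ?thesis using False unchanged by (auto simp: B' D')
      qed
    qed
  next
    case False
    then show ?thesis using best by (auto simp: B'_def D'_def best_arcs_def)
  qed
qed

end

section \<open>Correctness of the program\<close>

text \<open>The list stored as a linked list at pointer \<open>p\<close>, with pointers shifted by one.\<close>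
fun chain :: "(nat \<Rightarrow> nat) \<Rightarrow> nat \<Rightarrow> nat list \<Rightarrow> bool" where
  "chain f p [] \<longleftrightarrow> p = 0"
| "chain f p (i # xs) \<longleftrightarrow> p = Suc i \<and> chain f (f i) xs"

lemma chain_fun_upd [simp]: "k \<notin> set xs \<Longrightarrow> chain (f(k := c)) p xs \<longleftrightarrow> chain f p xs"
  by (induction xs arbitrary: p) auto

lemma chain_0 [simp]: "chain f 0 xs \<longleftrightarrow> xs = []"
  by (cases xs) auto

lemma map_fun_upd_upt: "map (f(n := x)) [0..<Suc n] = map f [0..<n] @ [x]"
  by simp

locale shortest_path = ranked_arcs m org dst rank
  for m :: nat and org dst rank :: "nat \<Rightarrow> nat" +
  fixes w :: "nat \<Rightarrow> ereal" and s q :: nat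
begin

definition input :: "memory \<Rightarrow> bool" where
  "input \<sigma> \<longleftrightarrow> nats \<sigma> ''arcs'' 0 = m \<and> nats \<sigma> ''tail'' = org \<and> nats \<sigma> ''head'' = dst \<and>
     costs \<sigma> ''weight'' = w \<and> nats \<sigma> ''source'' 0 = s \<and> nats \<sigma> ''target'' 0 = q"

definition ends :: "nat \<Rightarrow> nat set" where
  "ends n = org ` {..<n} \<union> dst ` {..<n}"

lemma ends_Suc: "ends (Suc n) = insert (org n) (insert (dst n) (ends n))"
  by (auto simp: ends_def lessThan_Suc)

lemma endsI: "i < n \<Longrightarrow> org i \<in> ends n" "i < n \<Longrightarrow> dst i \<in> ends n"
  by (auto simp: ends_def)

lemma arcs_into_Suc: "arcs_into (Suc n) v = (if dst n = v then n # arcs_into n v else arcs_into n v)"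
  by (simp add: arcs_into_def)

lemma fresh_arc [simp]: "n \<notin> set (arcs_into n v)"
  by (simp add: arcs_into_def)

lemma card_out_Suc:
  "card {k. k < Suc n \<and> org k = v} = (if org n = v then Suc (card {k. k < n \<and> org k = v}) else card {k. k < n \<and> org k = v})"
proof -
  have "{k. k < Suc n \<and> org k = v} =
      (if org n = v then insert n {k. k < n \<and> org k = v} else {k. k < n \<and> org k = v})"
    by (auto simp: less_Suc_eq)
  then show ?thesis by simp
qed

text \<open>
  The argument \<open>i\<close> of this predicate and of those below is the number of arcs
  that the loop establishing it has handled.
\<close>
definition unreached :: "nat \<Rightarrow> memory \<Rightarrow> bool" where
  "unreached i \<sigma> \<longleftrightarrow> (\<forall>v\<in>insert s (ends i). nats \<sigma> ''best'' v = Suc m)"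

definition cleared :: "nat \<Rightarrow> memory \<Rightarrow> bool" where
  "cleared i \<sigma> \<longleftrightarrow> input \<sigma> \<and> i \<le> m \<and> unreached i \<sigma> \<and>
     (\<forall>v\<in>ends i. nats \<sigma> ''outdeg'' v = 0 \<and> nats \<sigma> ''first'' v = 0)"

text \<open>
  In each part of the program, 20 is a crude bound for the steps of the initialization and 100 for
  those of one iteration.
\<close>
lemma clear_phase:
  assumes "input \<sigma>"
  shows "runs clear_phase \<sigma> (20 + Suc m * 100) (cleared m)"
proof -
  have "runs clear_phase \<sigma> (max_steps (block [nassign ''i'' (Const 0), NSet ''best'' (nvar ''source'') (succ (nvar ''arcs''))])
      + Suc m * iteration_steps more_arcs clear_body) (cleared m)"
    unfolding clear_phase_def
  proof (rule runs_phase[where I = "\<lambda>\<sigma>. cleared (nats \<sigma> ''i'' 0) \<sigma>" and var = "\<lambda>\<sigma>. m - nats \<sigma> ''i'' 0"])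
    fix \<sigma> assume \<sigma>: "cleared (nats \<sigma> ''i'' 0) \<sigma>" "bval more_arcs \<sigma>"
    then show "cleared (nats (effect clear_body \<sigma>) ''i'' 0) (effect clear_body \<sigma>) \<and>
        m - nats (effect clear_body \<sigma>) ''i'' 0 < m - nats \<sigma> ''i'' 0"
      by (auto simp: cleared_def unreached_def input_def clear_body_def more_arcs_def Let_def ends_Suc)
  qed (use assms in \<open>auto simp: cleared_def unreached_def input_def more_arcs_def clear_body_def Let_def ends_def\<close>)
  then show ?thesis
    by (rule runs_mono) (simp_all add: iteration_steps_def more_arcs_def clear_body_def Let_def)
qed

definition linked :: "nat \<Rightarrow> memory \<Rightarrow> bool" where
  "linked i \<sigma> \<longleftrightarrow> input \<sigma> \<and> unreached m \<sigma> \<and>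
     (\<forall>v\<in>ends m. chain (nats \<sigma> ''next'') (nats \<sigma> ''first'' v) (arcs_into i v))"

definition counted :: "nat \<Rightarrow> memory \<Rightarrow> bool" where
  "counted i \<sigma> \<longleftrightarrow> (\<forall>v\<in>ends m. nats \<sigma> ''outdeg'' v = card {k. k < i \<and> org k = v})"

lemma link_phase:
  assumes "cleared m \<sigma>"
  shows "runs link_phase \<sigma> (20 + Suc m * 100) (\<lambda>\<sigma>. linked m \<sigma> \<and> counted m \<sigma>)"
proof -
  have "runs link_phase \<sigma> (max_steps (nassign ''i'' (Const 0))
      + Suc m * iteration_steps more_arcs link_body) (\<lambda>\<sigma>. linked m \<sigma> \<and> counted m \<sigma>)"
    unfolding link_phase_def
  proof (rule runs_phase[where I = "\<lambda>\<sigma>. nats \<sigma> ''i'' 0 \<le> m \<and> linked (nats \<sigma> ''i'' 0) \<sigma> \<and> counted (nats \<sigma> ''i'' 0) \<sigma>"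
        and var = "\<lambda>\<sigma>. m - nats \<sigma> ''i'' 0"])
    fix \<sigma> assume \<sigma>: "nats \<sigma> ''i'' 0 \<le> m \<and> linked (nats \<sigma> ''i'' 0) \<sigma> \<and> counted (nats \<sigma> ''i'' 0) \<sigma>"
      "bval more_arcs \<sigma>"
    then have "nats \<sigma> ''i'' 0 < m" by (auto simp: linked_def input_def more_arcs_def)
    with \<sigma> show "(nats (effect link_body \<sigma>) ''i'' 0 \<le> m \<and> linked (nats (effect link_body \<sigma>) ''i'' 0) (effect link_body \<sigma>) \<and>
        counted (nats (effect link_body \<sigma>) ''i'' 0) (effect link_body \<sigma>)) \<and>
        m - nats (effect link_body \<sigma>) ''i'' 0 < m - nats \<sigma> ''i'' 0"
      by (auto simp: linked_def counted_def unreached_def input_def link_body_def Let_def arcs_into_Suc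
          card_out_Suc endsI)
  qed (use assms in \<open>auto simp: cleared_def linked_def counted_def unreached_def input_def more_arcs_def
      link_body_def Let_def arcs_into_def\<close>)
  then show ?thesis
    by (rule runs_mono) (simp_all add: iteration_steps_def more_arcs_def link_body_def Let_def)
qed

abbreviation order_upto :: "nat \<Rightarrow> memory \<Rightarrow> nat list" where
  "order_upto n \<sigma> \<equiv> map (nats \<sigma> ''order'') [0..<n]"

definition seeded :: "nat \<Rightarrow> memory \<Rightarrow> bool" where
  "seeded i \<sigma> \<longleftrightarrow> linked m \<sigma> \<and> counted m \<sigma> \<and> i \<le> m \<and>
     order_upto (nats \<sigma> ''n'' 0) \<sigma> = filter (\<lambda>k. out (dst k) = {}) [0..<i]"

lemma counted_outdeg: "counted m \<sigma> \<Longrightarrow> v \<in> ends m \<Longrightarrow> nats \<sigma> ''outdeg'' v = card (out v)"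
  by (simp add: counted_def out_def)

lemma seed_phase:
  assumes "linked m \<sigma>" "counted m \<sigma>"
  shows "runs seed_phase \<sigma> (20 + Suc m * 100) (seeded m)"
proof -
  have "runs seed_phase \<sigma> (max_steps (block [nassign ''i'' (Const 0), nassign ''n'' (Const 0)])
      + Suc m * iteration_steps more_arcs seed_body) (seeded m)"
    unfolding seed_phase_def
  proof (rule runs_phase[where I = "\<lambda>\<sigma>. seeded (nats \<sigma> ''i'' 0) \<sigma>" and var = "\<lambda>\<sigma>. m - nats \<sigma> ''i'' 0"])
    fix \<sigma> assume \<sigma>: "seeded (nats \<sigma> ''i'' 0) \<sigma>" "bval more_arcs \<sigma>"
    then have i: "nats \<sigma> ''i'' 0 < m" and head: "nats \<sigma> ''head'' = dst"
      by (auto simp: seeded_def linked_def input_def more_arcs_def)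
    have "nats \<sigma> ''outdeg'' (dst (nats \<sigma> ''i'' 0)) = card (out (dst (nats \<sigma> ''i'' 0)))"
      using \<sigma>(1) i by (intro counted_outdeg endsI) (auto simp: seeded_def)
    with \<sigma> i head show "seeded (nats (effect seed_body \<sigma>) ''i'' 0) (effect seed_body \<sigma>) \<and>
        m - nats (effect seed_body \<sigma>) ''i'' 0 < m - nats \<sigma> ''i'' 0"
      by (auto simp: seeded_def linked_def counted_def unreached_def input_def seed_body_def)
  qed (use assms in \<open>auto simp: seeded_def linked_def counted_def unreached_def input_def more_arcs_def
      seed_body_def\<close>)
  then show ?thesis
    by (rule runs_mono) (simp_all add: iteration_steps_def more_arcs_def seed_body_def)
qed

text \<open>
  The queue of the abstract sort is the part of \<open>order\<close> written so far followed by the pending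
  list.  Appending a pending arc therefore does not change the abstract queue.
\<close>
definition sorting :: "memory \<Rightarrow> bool" where
  "sorting \<sigma> \<longleftrightarrow> linked m \<sigma> \<and> nats \<sigma> ''j'' 0 \<le> nats \<sigma> ''n'' 0 \<and>
     (\<exists>P. chain (nats \<sigma> ''next'') (nats \<sigma> ''pending'' 0) P \<and>
        arc_queue (nats \<sigma> ''j'' 0) (order_upto (nats \<sigma> ''n'' 0) \<sigma> @ P)) \<and>
     (\<forall>v\<in>ends m. nats \<sigma> ''outdeg'' v = card (out v - set (order_upto (nats \<sigma> ''j'' 0) \<sigma>)))"

text \<open>
  Each iteration increases either the number of written arcs or the number of processed arcs by one,
  and neither exceeds the number of arcs.
\<close>
lemma sorting_step:
  assumes "sorting \<sigma>" "bval sort_test \<sigma>"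
  defines "\<sigma>' \<equiv> effect sort_body \<sigma>"
  shows "sorting \<sigma>' \<and> 2 * m - (nats \<sigma>' ''j'' 0 + nats \<sigma>' ''n'' 0) < 2 * m - (nats \<sigma> ''j'' 0 + nats \<sigma> ''n'' 0)"
proof -
  define j n where "j = nats \<sigma> ''j'' 0" and "n = nats \<sigma> ''n'' 0"
  obtain P where linked: "linked m \<sigma>" and "j \<le> n"
    and P: "chain (nats \<sigma> ''next'') (nats \<sigma> ''pending'' 0) P"
    and queue: "arc_queue j (order_upto n \<sigma> @ P)"
    and outdeg: "\<And>v. v \<in> ends m \<Longrightarrow> nats \<sigma> ''outdeg'' v = card (out v - set (order_upto j \<sigma>))"
    using assms(1) unfolding sorting_def j_def n_def by blast
  have inp: "input \<sigma>" using linked by (simp add: linked_def)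
  have length: "n + length P \<le> m" using arc_queue_length[OF queue] by simp
  show ?thesis
  proof (cases P)
    case (Cons i P')
    then have pending: "nats \<sigma> ''pending'' 0 = Suc i" "chain (nats \<sigma> ''next'') (nats \<sigma> ''next'' i) P'"
      using P by auto
    have j': "nats \<sigma>' ''j'' 0 = j" and n': "nats \<sigma>' ''n'' 0 = Suc n"
      and next': "nats \<sigma>' ''next'' = nats \<sigma> ''next''" and pending': "nats \<sigma>' ''pending'' 0 = nats \<sigma> ''next'' i"
      and outdeg': "nats \<sigma>' ''outdeg'' = nats \<sigma> ''outdeg''"
      and order': "nats \<sigma>' ''order'' = (nats \<sigma> ''order'')(n := i)"
      and linked': "linked m \<sigma>'"
      using pending(1) linked
      by (simp_all add: \<sigma>'_def sort_body_def Let_def j_def n_def linked_def unreached_def input_def)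
    have "order_upto (Suc n) \<sigma>' @ P' = order_upto n \<sigma> @ P"
      unfolding order' map_fun_upd_upt by (simp add: Cons)
    moreover have "order_upto j \<sigma>' = order_upto j \<sigma>"
      using \<open>j \<le> n\<close> by (simp add: order')
    ultimately have "sorting \<sigma>'"
      unfolding sorting_def j' n' next' pending' outdeg'
      using linked' \<open>j \<le> n\<close> pending(2) queue outdeg by (metis le_SucI)
    then show ?thesis
      using length \<open>j \<le> n\<close> by (simp add: j' n' Cons flip: j_def n_def)
  next
    case Nil
    then have pending: "nats \<sigma> ''pending'' 0 = 0" using P by simp
    then have "j < n" using assms(2) by (simp add: sort_test_def j_def n_def)
    define e v where "e = nats \<sigma> ''order'' j" and "v = org e"
    have e: "order_upto n \<sigma> ! j = e" using \<open>j < n\<close> by (simp add: e_def)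
    have "e \<in> set (order_upto n \<sigma>)" using \<open>j < n\<close> by (auto simp: e_def)
    then have "e < m" using queue unfolding arc_queue_def Nil by auto
    then have "v \<in> ends m" by (simp add: v_def endsI)
    have take: "take (Suc j) (order_upto n \<sigma>) = order_upto (Suc j) \<sigma>"
      using \<open>j < n\<close> by (simp add: take_map)
    have "e \<notin> set (order_upto j \<sigma>)"
    proof -
      have "distinct (order_upto (Suc j) \<sigma>)"
        using queue unfolding Nil arc_queue_def take[symmetric] by (simp add: distinct_take)
      then show ?thesis by (simp add: e_def)
    qed
    then have "e \<in> out v - set (order_upto j \<sigma>)"
      using \<open>e < m\<close> by (simp add: out_def v_def)
    moreover have done_Suc: "set (order_upto (Suc j) \<sigma>) = insert e (set (order_upto j \<sigma>))"
      by (simp add: e_def)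
    ultimately have v_outdeg: "nats \<sigma> ''outdeg'' v - Suc 0 = card (out v - set (order_upto (Suc j) \<sigma>))"
      unfolding outdeg[OF \<open>v \<in> ends m\<close>] done_Suc Diff_insert[of "out v" e]
      by (subst card_Diff_singleton) simp_all
    have "e \<notin> out u" if "u \<noteq> v" for u
      using that by (simp add: out_def v_def)
    then have u_outdeg: "out u - set (order_upto (Suc j) \<sigma>) = out u - set (order_upto j \<sigma>)" if "u \<noteq> v" for u
      using that unfolding done_Suc by blast
    \<comment> \<open>The counter of \<open>v\<close> drops to zero iff the last arc out of \<open>v\<close> has just been processed.\<close>
    define b where "b = (out v \<subseteq> set (order_upto (Suc j) \<sigma>))"
    have b: "b \<longleftrightarrow> nats \<sigma> ''outdeg'' v - Suc 0 = 0"
      unfolding v_outdeg b_def card_0_eq[OF finite_Diff[OF finite_out]] by blast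
    have j': "nats \<sigma>' ''j'' 0 = Suc j" and n': "nats \<sigma>' ''n'' 0 = n"
      and next': "nats \<sigma>' ''next'' = nats \<sigma> ''next''"
      and pending': "nats \<sigma>' ''pending'' 0 = (if b then nats \<sigma> ''first'' v else 0)"
      and outdeg': "nats \<sigma>' ''outdeg'' = (nats \<sigma> ''outdeg'')(v := nats \<sigma> ''outdeg'' v - Suc 0)"
      and order': "nats \<sigma>' ''order'' = nats \<sigma> ''order''"
      and linked': "linked m \<sigma>'"
      using pending linked inp b
      by (simp_all add: \<sigma>'_def sort_body_def Let_def j_def n_def e_def v_def linked_def unreached_def input_def)
    have "chain (nats \<sigma> ''next'') (if b then nats \<sigma> ''first'' v else 0) (if b then arcs_into m v else [])"
      using linked \<open>v \<in> ends m\<close> by (simp add: linked_def)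
    moreover have "arc_queue (Suc j) (order_upto n \<sigma> @ (if b then arcs_into m v else []))"
      using arc_queue_step[of j "order_upto n \<sigma>"] queue \<open>j < n\<close>
      unfolding Nil e take b_def v_def by simp
    moreover have "nats \<sigma>' ''outdeg'' u = card (out u - set (order_upto (Suc j) \<sigma>))" if "u \<in> ends m" for u
      using outdeg[OF that] v_outdeg u_outdeg[of u] unfolding outdeg' by (cases "u = v") auto
    ultimately have "sorting \<sigma>'"
      unfolding sorting_def j' n' next' pending' order'
      using linked' \<open>j < n\<close> by (metis Suc_leI)
    then show ?thesis
      using length \<open>j < n\<close> by (simp add: j' n' flip: j_def n_def)
  qed
qed

definition sorted_arcs :: "memory \<Rightarrow> bool" where
  "sorted_arcs \<sigma> \<longleftrightarrow> input \<sigma> \<and> unreached m \<sigma> \<and> arc_order (order_upto m \<sigma>)"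

lemma sort_phase:
  assumes "seeded m \<sigma>"
  shows "runs sort_phase \<sigma> (20 + Suc (2 * m) * 100) sorted_arcs"
proof -
  have "runs sort_phase \<sigma> (max_steps (block [nassign ''j'' (Const 0), nassign ''pending'' (Const 0)])
      + Suc (2 * m) * iteration_steps sort_test sort_body) sorted_arcs"
    unfolding sort_phase_def
  proof (rule runs_phase[where I = sorting and var = "\<lambda>\<sigma>. 2 * m - (nats \<sigma> ''j'' 0 + nats \<sigma> ''n'' 0)"])
    let ?A = "block [nassign ''j'' (Const 0), nassign ''pending'' (Const 0)]"
    have "linked m (effect ?A \<sigma>)"
      using assms by (simp add: seeded_def linked_def unreached_def input_def)
    moreover have "arc_queue 0 (order_upto (nats \<sigma> ''n'' 0) \<sigma>)"
    proof -
      have order: "order_upto (nats \<sigma> ''n'' 0) \<sigma> = filter (\<lambda>k. out (dst k) = {}) [0..<m]"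
        using assms by (simp add: seeded_def)
      have "out (dst (order_upto (nats \<sigma> ''n'' 0) \<sigma> ! a)) = {}" if "a < length (order_upto (nats \<sigma> ''n'' 0) \<sigma>)" for a
        using nth_mem[OF that] unfolding order by simp
      then show ?thesis
        unfolding arc_queue_def by (auto simp: order simp del: length_map map_map)
    qed
    ultimately show "sorting (effect ?A \<sigma>)"
      using assms counted_outdeg[of \<sigma>] by (simp add: sorting_def seeded_def)
  next
    fix \<sigma> assume \<sigma>: "sorting \<sigma>" "\<not> bval sort_test \<sigma>"
    then have pending: "nats \<sigma> ''pending'' 0 = 0" "nats \<sigma> ''j'' 0 = nats \<sigma> ''n'' 0"
      by (auto simp: sorting_def sort_test_def)
    with \<sigma>(1) have "arc_queue (nats \<sigma> ''n'' 0) (order_upto (nats \<sigma> ''n'' 0) \<sigma>)"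
      by (auto simp: sorting_def)
    then have order: "arc_order (order_upto (nats \<sigma> ''n'' 0) \<sigma>)"
      by (intro arc_queue_arc_order) simp
    from arc_order_length[OF this] have "nats \<sigma> ''n'' 0 = m" by simp
    with \<sigma>(1) order show "sorted_arcs \<sigma>"
      by (simp add: sorted_arcs_def sorting_def linked_def)
  qed (use sorting_step in \<open>auto simp: sort_body_def Let_def\<close>)
  then show ?thesis
    by (rule runs_mono) (simp_all add: iteration_steps_def sort_test_def sort_body_def Let_def)
qed

definition relaxed :: "nat \<Rightarrow> memory \<Rightarrow> bool" where
  "relaxed i \<sigma> \<longleftrightarrow> input \<sigma> \<and> i \<le> m \<and> arc_order (order_upto m \<sigma>) \<and>
     lower_bounds w q (set (order_upto i \<sigma>)) (nats \<sigma> ''best'') (costs \<sigma> ''dist'') \<and>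
     best_arcs w s q (set (order_upto i \<sigma>)) (nats \<sigma> ''best'') (costs \<sigma> ''dist'')"

lemma relaxed_step:
  assumes "relaxed (nats \<sigma> ''i'' 0) \<sigma>" "bval more_arcs \<sigma>"
  defines "\<sigma>' \<equiv> effect relax_body \<sigma>"
  shows "relaxed (nats \<sigma>' ''i'' 0) \<sigma>' \<and> m - nats \<sigma>' ''i'' 0 < m - nats \<sigma> ''i'' 0"
proof -
  define i where "i = nats \<sigma> ''i'' 0"
  define e where "e = nats \<sigma> ''order'' i"
  define S where "S = set (order_upto i \<sigma>)"
  let ?B = "nats \<sigma> ''best''" and ?D = "costs \<sigma> ''dist''"
  have inp: "input \<sigma>" and order: "arc_order (order_upto m \<sigma>)"
    and lower: "lower_bounds w q S ?B ?D" and best: "best_arcs w s q S ?B ?D"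
    using assms(1) by (simp_all add: relaxed_def i_def S_def)
  have "i < m" using assms(2) inp by (simp add: more_arcs_def input_def i_def)
  have take: "take a (order_upto m \<sigma>) = order_upto a \<sigma>" if "a \<le> m" for a
    using that by (simp add: take_map)
  have out: "out (dst (nats \<sigma> ''order'' a)) \<subseteq> set (order_upto a \<sigma>)" if "a < m" for a
  proof -
    have "a < length (order_upto m \<sigma>)" using that by simp
    then have "out (dst (order_upto m \<sigma> ! a)) \<subseteq> set (take a (order_upto m \<sigma>))"
      using order unfolding arc_order_def by blast
    then show ?thesis using that unfolding take[OF less_imp_le[OF that]] by simp
  qed
  have S_sub: "S \<subseteq> {..<m}"
    using order \<open>i < m\<close> unfolding S_def arc_order_def take[OF less_imp_le[OF \<open>i < m\<close>], symmetric]
    by (metis set_take_subset)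
  have S_closed: "out (dst k) \<subseteq> S" if k: "k \<in> S" for k
  proof -
    obtain a where "a < i" "k = nats \<sigma> ''order'' a" using k by (auto simp: S_def)
    then show ?thesis using out[of a] \<open>i < m\<close> by (fastforce simp: S_def)
  qed
  have "e \<in> set (order_upto m \<sigma>)" using \<open>i < m\<close> by (auto simp: e_def)
  then have "e < m" using order by (auto simp: arc_order_def)
  have "distinct (order_upto (Suc i) \<sigma>)"
    using order \<open>i < m\<close> take[of "Suc i"] unfolding arc_order_def by (metis Suc_leI distinct_take)
  then have "e \<notin> S" by (simp add: e_def S_def)
  have "out (dst e) \<subseteq> S" using out[OF \<open>i < m\<close>] by (simp add: e_def S_def)
  define improves where
    "improves \<longleftrightarrow> ?B (dst e) \<le> m \<and> (?B (org e) \<le> m \<longrightarrow> w e + ?D (dst e) < ?D (org e))"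
  have B': "nats \<sigma>' ''best'' = (if improves then ?B(org e := e) else ?B)"
    and D': "costs \<sigma>' ''dist'' = (if improves then ?D(org e := w e + ?D (dst e)) else ?D)"
    and i': "nats \<sigma>' ''i'' 0 = Suc i" and order': "nats \<sigma>' ''order'' = nats \<sigma> ''order''"
    and inp': "input \<sigma>'"
    using inp by (simp_all add: \<sigma>'_def relax_body_def Let_def input_def e_def i_def improves_def less_Suc_eq_le)
      auto
  have S': "set (order_upto (Suc i) \<sigma>) = insert e S" by (simp add: e_def S_def)
  have "lower_bounds w q (insert e S) (nats \<sigma>' ''best'') (costs \<sigma>' ''dist'')"
    and "best_arcs w s q (insert e S) (nats \<sigma>' ''best'') (costs \<sigma>' ''dist'')"
    unfolding B' D' improves_def
    using S_sub S_closed \<open>e < m\<close> \<open>e \<notin> S\<close> \<open>out (dst e) \<subseteq> S\<close> lower best by (intro relax_step; blast)+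
  then show ?thesis
    using inp' order \<open>i < m\<close> S' by (simp add: relaxed_def i' order' flip: i_def)
qed

lemma relax_phase:
  assumes "sorted_arcs \<sigma>"
  shows "runs relax_phase \<sigma> (20 + Suc m * 100) (relaxed m)"
proof -
  let ?A = "block [nassign ''i'' (Const 0), NSet ''best'' (nvar ''target'') (nvar ''arcs''),
      CSet ''dist'' (nvar ''target'') Zero]"
  have "runs relax_phase \<sigma> (max_steps ?A + Suc m * iteration_steps more_arcs relax_body) (relaxed m)"
    unfolding relax_phase_def
  proof (rule runs_phase[where I = "\<lambda>\<sigma>. relaxed (nats \<sigma> ''i'' 0) \<sigma>" and var = "\<lambda>\<sigma>. m - nats \<sigma> ''i'' 0"])
    have inp: "input \<sigma>" and order: "arc_order (order_upto m \<sigma>)"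
      using assms by (simp_all add: sorted_arcs_def)
    have unreached: "nats \<sigma> ''best'' v = Suc m" if "v \<in> vertices s q" "v \<noteq> q" for v
      using assms that by (auto simp: sorted_arcs_def unreached_def vertices_def ends_def)
    have "lower_bounds w q {} (nats (effect ?A \<sigma>) ''best'') (costs (effect ?A \<sigma>) ''dist'')"
      using inp by (auto simp: lower_bounds_def input_def cost_def)
    moreover have "best_arcs w s q {} (nats (effect ?A \<sigma>) ''best'') (costs (effect ?A \<sigma>) ''dist'')"
      using inp unreached by (auto simp: best_arcs_def input_def)
    ultimately show "relaxed (nats (effect ?A \<sigma>) ''i'' 0) (effect ?A \<sigma>)"
      using inp order by (simp add: relaxed_def input_def)
  next
    fix \<sigma> assume "relaxed (nats \<sigma> ''i'' 0) \<sigma>" "bval more_arcs \<sigma>"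
    then show "relaxed (nats (effect relax_body \<sigma>) ''i'' 0) (effect relax_body \<sigma>) \<and>
        m - nats (effect relax_body \<sigma>) ''i'' 0 < m - nats \<sigma> ''i'' 0"
      by (rule relaxed_step)
  next
    fix \<sigma> assume "relaxed (nats \<sigma> ''i'' 0) \<sigma>" "\<not> bval more_arcs \<sigma>"
    moreover from this have "nats \<sigma> ''i'' 0 = m"
      by (auto simp: relaxed_def input_def more_arcs_def)
    ultimately show "relaxed m \<sigma>" by simp
  qed (simp_all add: relax_body_def Let_def)
  then show ?thesis
    by (rule runs_mono) (simp_all add: iteration_steps_def more_arcs_def relax_body_def Let_def)
qed

abbreviation traced_path :: "memory \<Rightarrow> nat list" where
  "traced_path \<sigma> \<equiv> map (nats \<sigma> ''path'') [0..<nats \<sigma> ''length'' 0]"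

text \<open>
  The cost of the source splits into the cost of the path traced so far and the cost of the current
  vertex.
\<close>
definition tracing :: "memory \<Rightarrow> bool" where
  "tracing \<sigma> \<longleftrightarrow> relaxed m \<sigma> \<and>
     (if nats \<sigma> ''best'' s \<le> m
      then walk s (traced_path \<sigma>) (nats \<sigma> ''v'' 0) \<and> nats \<sigma> ''v'' 0 \<in> vertices s q \<and>
        nats \<sigma> ''best'' (nats \<sigma> ''v'' 0) \<le> m \<and>
        costs \<sigma> ''dist'' s = cost w (traced_path \<sigma>) + costs \<sigma> ''dist'' (nats \<sigma> ''v'' 0)
      else nats \<sigma> ''v'' 0 = s \<and> nats \<sigma> ''length'' 0 = 0)"

text \<open>
  The arcs that may still be appended to a walk that has arrived at \<open>v\<close>, and possibly more.
  Their number bounds the remaining iterations of the tracing loop; a difference of ranks would not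
  be bounded by the number of arcs.
\<close>
definition arcs_after :: "nat \<Rightarrow> nat set" where
  "arcs_after v = {k. k < m \<and> rank v \<le> rank (org k)}"

lemma relaxed_best:
  assumes "relaxed m \<sigma>" "v \<in> vertices s q" "nats \<sigma> ''best'' v \<le> m"
  shows "v = q \<and> nats \<sigma> ''best'' v = m \<and> costs \<sigma> ''dist'' v = 0 \<or>
    nats \<sigma> ''best'' v < m \<and> org (nats \<sigma> ''best'' v) = v \<and> nats \<sigma> ''best'' (dst (nats \<sigma> ''best'' v)) \<le> m \<and>
    costs \<sigma> ''dist'' v = w (nats \<sigma> ''best'' v) + costs \<sigma> ''dist'' (dst (nats \<sigma> ''best'' v))"
proof -
  have "set (order_upto m \<sigma>) = {..<m}"
    using assms(1) unfolding relaxed_def arc_order_def by blast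
  then have "best_arcs w s q {..<m} (nats \<sigma> ''best'') (costs \<sigma> ''dist'')"
    using assms(1) unfolding relaxed_def by simp
  then show ?thesis
    using assms(2,3) unfolding best_arcs_def by (blast dest: lessThan_iff[THEN iffD1])
qed

lemma relaxed_lower_bound:
  assumes "relaxed m \<sigma>" "walk v p q"
  shows "nats \<sigma> ''best'' v \<le> m" "costs \<sigma> ''dist'' v \<le> cost w p"
proof -
  have "set (order_upto m \<sigma>) = {..<m}"
    using assms(1) unfolding relaxed_def arc_order_def by blast
  then have "lower_bounds w q {..<m} (nats \<sigma> ''best'') (costs \<sigma> ''dist'')"
    using assms(1) unfolding relaxed_def by simp
  moreover have "p \<noteq> [] \<longrightarrow> hd p \<in> {..<m}" using assms(2) by (cases p) auto
  ultimately show "nats \<sigma> ''best'' v \<le> m" "costs \<sigma> ''dist'' v \<le> cost w p"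
    using assms(2) unfolding lower_bounds_def by blast+
qed

lemma tracing_step:
  assumes "tracing \<sigma>" "bval trace_test \<sigma>"
  defines "\<sigma>' \<equiv> effect trace_body \<sigma>"
  shows "tracing \<sigma>' \<and> card (arcs_after (nats \<sigma>' ''v'' 0)) < card (arcs_after (nats \<sigma> ''v'' 0))"
proof -
  define v e where "v = nats \<sigma> ''v'' 0" and "e = nats \<sigma> ''best'' v"
  have relaxed: "relaxed m \<sigma>" and inp: "input \<sigma>" using assms(1) by (simp_all add: tracing_def relaxed_def)
  have "e < m" using assms(2) inp by (simp add: trace_test_def input_def v_def e_def)
  have reached: "nats \<sigma> ''best'' s \<le> m"
    using assms(1) \<open>e < m\<close> by (auto simp: tracing_def v_def e_def split: if_splits)
  then have walk: "walk s (traced_path \<sigma>) v" and v: "v \<in> vertices s q"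
    and dist: "costs \<sigma> ''dist'' s = cost w (traced_path \<sigma>) + costs \<sigma> ''dist'' v"
    using assms(1) by (simp_all add: tracing_def v_def)
  have e: "org e = v" "nats \<sigma> ''best'' (dst e) \<le> m" "costs \<sigma> ''dist'' v = w e + costs \<sigma> ''dist'' (dst e)"
    using relaxed_best[OF relaxed v] \<open>e < m\<close> by (auto simp: e_def)
  have v': "nats \<sigma>' ''v'' 0 = dst e" and best': "nats \<sigma>' ''best'' = nats \<sigma> ''best''"
    and dist': "costs \<sigma>' ''dist'' = costs \<sigma> ''dist''" and path': "traced_path \<sigma>' = traced_path \<sigma> @ [e]"
    and relaxed': "relaxed m \<sigma>'"
    using inp relaxed
    by (simp_all add: \<sigma>'_def trace_body_def input_def v_def e_def relaxed_def)
  have "tracing \<sigma>'"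
    unfolding tracing_def v' best' dist' path'
    using relaxed' reached walk dist e \<open>e < m\<close>
    by (auto simp: walk_append cost_def vertices_def add.assoc)
  moreover have "arcs_after (dst e) \<subseteq> arcs_after v" "e \<in> arcs_after v" "e \<notin> arcs_after (dst e)"
    using rank_less[OF \<open>e < m\<close>] \<open>e < m\<close> e(1) by (auto simp: arcs_after_def)
  then have "arcs_after (dst e) \<subset> arcs_after v" by blast
  then have "card (arcs_after (dst e)) < card (arcs_after v)"
    by (intro psubset_card_mono) (simp_all add: arcs_after_def)
  ultimately show ?thesis by (simp add: v' flip: v_def)
qed

definition optimal_walk :: "nat list \<Rightarrow> bool" where
  "optimal_walk p \<longleftrightarrow> walk s p q \<and> (\<forall>r. walk s r q \<longrightarrow> cost w p \<le> cost w r)"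

definition optimal_output :: "memory \<Rightarrow> bool" where
  "optimal_output \<sigma> \<longleftrightarrow>
     (if \<exists>r. walk s r q then optimal_walk (traced_path \<sigma>) else traced_path \<sigma> = [])"

lemma trace_phase:
  assumes "relaxed m \<sigma>"
  shows "runs trace_phase \<sigma> (20 + Suc m * 100) optimal_output"
proof -
  let ?A = "block [nassign ''length'' (Const 0), nassign ''v'' (nvar ''source'')]"
  have "runs trace_phase \<sigma> (max_steps ?A + Suc m * iteration_steps trace_test trace_body) optimal_output"
    unfolding trace_phase_def
  proof (rule runs_phase[where I = tracing and var = "\<lambda>\<sigma>. card (arcs_after (nats \<sigma> ''v'' 0))"])
    show "tracing (effect ?A \<sigma>)"
      using assms by (simp add: tracing_def relaxed_def input_def cost_def vertices_def)
    show "card (arcs_after (nats (effect ?A \<sigma>) ''v'' 0)) \<le> m"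
      using card_mono[of "{..<m}" "arcs_after (nats (effect ?A \<sigma>) ''v'' 0)"] by (auto simp: arcs_after_def)
  next
    fix \<sigma> assume "tracing \<sigma>" "bval trace_test \<sigma>"
    then show "tracing (effect trace_body \<sigma>) \<and>
        card (arcs_after (nats (effect trace_body \<sigma>) ''v'' 0)) < card (arcs_after (nats \<sigma> ''v'' 0))"
      by (rule tracing_step)
  next
    fix \<sigma> assume \<sigma>: "tracing \<sigma>" "\<not> bval trace_test \<sigma>"
    then have relaxed: "relaxed m \<sigma>" by (simp add: tracing_def)
    have stop: "m \<le> nats \<sigma> ''best'' (nats \<sigma> ''v'' 0)"
      using \<sigma> by (simp add: trace_test_def tracing_def relaxed_def input_def)
    show "optimal_output \<sigma>"
    proof (cases "nats \<sigma> ''best'' s \<le> m")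
      case True
      with \<sigma>(1) have walk: "walk s (traced_path \<sigma>) (nats \<sigma> ''v'' 0)" and v: "nats \<sigma> ''v'' 0 \<in> vertices s q"
        "nats \<sigma> ''best'' (nats \<sigma> ''v'' 0) \<le> m"
        and dist: "costs \<sigma> ''dist'' s = cost w (traced_path \<sigma>) + costs \<sigma> ''dist'' (nats \<sigma> ''v'' 0)"
        by (simp_all add: tracing_def)
      have "nats \<sigma> ''v'' 0 = q" "costs \<sigma> ''dist'' (nats \<sigma> ''v'' 0) = 0"
        using relaxed_best[OF relaxed v] stop by auto
      with walk dist have "walk s (traced_path \<sigma>) q" "costs \<sigma> ''dist'' s = cost w (traced_path \<sigma>)"
        by simp_all
      then show ?thesis
        using relaxed_lower_bound(2)[OF relaxed] unfolding optimal_output_def optimal_walk_def by metis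
    next
      case False
      then have "\<nexists>r. walk s r q" using relaxed_lower_bound(1)[OF relaxed] by blast
      moreover have "traced_path \<sigma> = []" using False \<sigma>(1) by (simp add: tracing_def)
      ultimately show ?thesis by (simp add: optimal_output_def)
    qed
  qed (simp_all add: trace_body_def)
  then show ?thesis
    by (rule runs_mono) (simp_all add: iteration_steps_def trace_test_def trace_body_def)
qed

text \<open>
  The six parts take at most \<open>700 * m + 720\<close> steps by the bounds above.
\<close>
theorem shortest_path_program_correct:
  assumes "input \<sigma>"
  shows "runs shortest_path_program \<sigma> (1000 * Suc m) optimal_output"
proof -
  have "runs shortest_path_program \<sigma> ((20 + Suc m * 100) + ((20 + Suc m * 100) + ((20 + Suc m * 100) +
      ((20 + Suc (2 * m) * 100) + ((20 + Suc m * 100) + (20 + Suc m * 100)))))) optimal_output"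
    unfolding shortest_path_program_def
    using assms by (intro runs_Seq[OF clear_phase] runs_Seq[OF link_phase] runs_Seq[OF seed_phase]
        runs_Seq[OF sort_phase] runs_Seq[OF relax_phase] trace_phase) auto
  then show ?thesis by (rule runs_mono) simp_all
qed

end

section \<open>Robust dispatch\<close>

lemma path_cost_conv_sum_list:
  assumes "distinct p"
  shows "path_cost M \<xi> p = sum_list (map (arc_cost M \<xi>) p)"
  using assms by (simp add: path_cost_def sum_list_distinct_conv_sum_set)

text \<open>
  Transfers the result from arc indices and vertex numbers to the encoded graph.  Walks correspond
  to each other because \<open>\<nu>\<close> is injective on the vertices and the arc list is exhaustive.
\<close>
lemma program_finds_shortest_path:
  fixes G :: "('v, 'e) pre_digraph" and level :: "'v \<Rightarrow> nat"
  assumes wf: "wf_digraph G" and enc: "encodes G c a b es \<nu> \<sigma>" and ends: "a \<in> verts G" "b \<in> verts G"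
    and level: "\<And>e. e \<in> arcs G \<Longrightarrow> level (tail G e) < level (head G e)"
  obtains n \<sigma>' p where "exec shortest_path_program \<sigma> n \<sigma>'" "n \<le> 1000 * Suc (card (arcs G))" "outputs es \<sigma>' p"
    "if \<exists>r. pre_digraph.awalk G a r b
     then pre_digraph.awalk G a p b \<and>
       (\<forall>r. pre_digraph.awalk G a r b \<longrightarrow> sum_list (map c p) \<le> sum_list (map c r))
     else p = []"
proof -
  interpret wf_digraph G by (rule wf)
  define m where "m = length es"
  define org dst w where "org = nats \<sigma> ''tail''" and "dst = nats \<sigma> ''head''" and "w = costs \<sigma> ''weight''"
  have distinct: "distinct es" and arcs: "set es = arcs G" and bij: "bij_betw \<nu> (verts G) {..<card (verts G)}"
    and org: "\<And>i. i < m \<Longrightarrow> org i = \<nu> (tail G (es ! i))"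
    and dst: "\<And>i. i < m \<Longrightarrow> dst i = \<nu> (head G (es ! i))"
    and w: "\<And>i. i < m \<Longrightarrow> w i = c (es ! i)"
    using enc by (simp_all add: encodes_def m_def org_def dst_def w_def)
  have card: "m = card (arcs G)" using distinct arcs distinct_card unfolding m_def by metis
  have inj: "inj_on \<nu> (verts G)" using bij by (simp add: bij_betw_def)
  have arc: "es ! i \<in> arcs G" if "i < m" for i using that unfolding m_def arcs[symmetric] by simp
  \<comment> \<open>Numbers that do not belong to a vertex get a meaningless rank, but no arc ends there.\<close>
  define rank where "rank = level \<circ> the_inv_into (verts G) \<nu>"
  have rank: "rank (\<nu> v) = level v" if "v \<in> verts G" for v
    using that inj by (simp add: rank_def the_inv_into_f_f)
  interpret shortest_path m org dst rank w "\<nu> a" "\<nu> b"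
    by standard (simp add: org dst rank arc level)
  have walk_decode: "set is \<subseteq> {..<m} \<and> awalk u (map ((!) es) is) v"
    if "walk (\<nu> u) is (\<nu> v)" "u \<in> verts G" "v \<in> verts G" for u v "is"
    using that
  proof (induction "is" arbitrary: u)
    case Nil
    then show ?case using inj by (auto simp: awalk_Nil_iff dest: inj_onD)
  next
    case (Cons i "is")
    then have i: "i < m" "\<nu> (tail G (es ! i)) = \<nu> u" "walk (\<nu> (head G (es ! i))) is (\<nu> v)"
      by (auto simp: org dst)
    then have "tail G (es ! i) = u" using inj Cons.prems(2) arc by (auto dest: inj_onD)
    then show ?case
      using Cons.IH[OF i(3)] Cons.prems(3) i(1) arc by (auto simp: awalk_Cons_iff)
  qed
  have walk_encode: "\<exists>is. walk (\<nu> u) is (\<nu> v) \<and> map ((!) es) is = r" if "awalk u r v" for u v r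
    using that
  proof (induction r arbitrary: u)
    case Nil
    then show ?case by (auto simp: awalk_Nil_iff)
  next
    case (Cons e r)
    then have e: "e \<in> arcs G" "tail G e = u" and r: "awalk (head G e) r v"
      by (auto simp: awalk_Cons_iff)
    then obtain i where i: "i < m" "es ! i = e" using arcs by (metis in_set_conv_nth m_def)
    from Cons.IH[OF r] obtain "is" where "walk (\<nu> (head G e)) is (\<nu> v)" "map ((!) es) is = r" by blast
    then show ?case using e i by (intro exI[of _ "i # is"]) (simp add: org dst)
  qed
  have cost_decode: "cost w is = sum_list (map c (map ((!) es) is))" if "set is \<subseteq> {..<m}" for "is"
    using that by (induction "is") (auto simp: cost_def w)
  have "input \<sigma>"
    using enc unfolding input_def by (simp add: encodes_def m_def org_def dst_def w_def)
  from shortest_path_program_correct[OF this] obtain n \<sigma>' where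
    run: "exec shortest_path_program \<sigma> n \<sigma>'" "n \<le> 1000 * Suc m" and opt: "optimal_output \<sigma>'"
    by (auto simp: runs_def)
  define p where "p = map ((!) es) (traced_path \<sigma>')"
  have walk_iff: "(\<exists>r. walk (\<nu> a) r (\<nu> b)) \<longleftrightarrow> (\<exists>r. awalk a r b)"
    using walk_decode[OF _ ends] walk_encode by blast
  have indices: "set (traced_path \<sigma>') \<subseteq> {..<m}"
  proof (cases "\<exists>r. walk (\<nu> a) r (\<nu> b)")
    case True
    then have "walk (\<nu> a) (traced_path \<sigma>') (\<nu> b)"
      using opt by (simp add: optimal_output_def optimal_walk_def)
    with walk_decode[OF _ ends] show ?thesis by blast
  next
    case False
    then show ?thesis using opt by (simp add: optimal_output_def)
  qed
  have "outputs es \<sigma>' p"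
    using indices unfolding outputs_def p_def m_def by (simp add: image_subset_iff)
  moreover have "if \<exists>r. awalk a r b
     then awalk a p b \<and> (\<forall>r. awalk a r b \<longrightarrow> sum_list (map c p) \<le> sum_list (map c r)) else p = []"
  proof (cases "\<exists>r. awalk a r b")
    case True
    then have opt: "walk (\<nu> a) (traced_path \<sigma>') (\<nu> b)"
      "\<And>is. walk (\<nu> a) is (\<nu> b) \<Longrightarrow> cost w (traced_path \<sigma>') \<le> cost w is"
      using opt unfolding optimal_output_def optimal_walk_def walk_iff by simp_all
    have "sum_list (map c p) \<le> sum_list (map c r)" if r: "awalk a r b" for r
    proof -
      obtain "is" where "is": "walk (\<nu> a) is (\<nu> b)" "map ((!) es) is = r" using walk_encode[OF r] by blast
      show ?thesis
        using opt(2)[OF "is"(1)] cost_decode[OF indices] cost_decode[of "is"] walk_decode[OF "is"(1) ends] "is"(2)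
        by (simp add: p_def)
    qed
    then show ?thesis using True walk_decode[OF opt(1) ends] by (simp add: p_def)
  next
    case False
    then show ?thesis
      using opt unfolding optimal_output_def walk_iff by (simp add: p_def)
  qed
  ultimately show ?thesis using that run card by blast
qed

lemma dispatch_paths_conv_awalk:
  assumes "turbine_model M"
  shows "p \<in> dispatch_paths M \<longleftrightarrow> pre_digraph.awalk (dispatch_graph M) Source p Terminal"
    and "p \<in> dispatch_paths M \<Longrightarrow> distinct p"
  using ranked_awalk[of "dispatch_graph M" "vertex_time (horizon M)", OF vertex_time_less[OF assms]]
  by (auto simp: dispatch_paths_def pre_digraph.apath_def)

lemma finite_dispatch_paths:
  assumes "turbine_model M"
  shows "finite (dispatch_paths M)"
  unfolding dispatch_paths_def using fin_digraph.apaths_finite[OF fin_digraph_dispatch_graph[OF assms]] .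

lemma is_arg_min_cong:
  assumes "\<And>x. P x \<Longrightarrow> f x = g x"
  shows "is_arg_min f P x \<longleftrightarrow> is_arg_min g P x"
  using assms by (auto simp: is_arg_min_def)

lemma robust_dispatch_equivalence:
  fixes P\<^sub>0 H\<^sub>0 :: "nat \<Rightarrow> real"
  assumes "dispatch_model M" "error_bounds (horizon M) \<Delta>P \<Delta>H"
  defines "W \<equiv> demand_box (horizon M) P\<^sub>0 H\<^sub>0 \<Delta>P \<Delta>H"
    and "\<xi> \<equiv> worst_profile (horizon M) P\<^sub>0 H\<^sub>0 \<Delta>P \<Delta>H"
  shows "p \<in> dispatch_paths M \<Longrightarrow> robust_cost M W p = path_cost M \<xi> p"
    and "is_arg_min (robust_cost M W) (\<lambda>p. p \<in> dispatch_paths M) p \<longleftrightarrow>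
      is_arg_min (path_cost M \<xi>) (\<lambda>p. p \<in> dispatch_paths M) p"
proof -
  show eq: "robust_cost M W p = path_cost M \<xi> p" if "p \<in> dispatch_paths M" for p
    using assms(1,2) dispatch_paths_arcs[OF that]
    by (simp add: W_def \<xi>_def dispatch_model_def robust_cost_eq_worst_profile)
  then show "is_arg_min (robust_cost M W) (\<lambda>p. p \<in> dispatch_paths M) p \<longleftrightarrow>
      is_arg_min (path_cost M \<xi>) (\<lambda>p. p \<in> dispatch_paths M) p"
    by (rule is_arg_min_cong)
qed

lemma program_solves_robust_dispatch:
  assumes model: "dispatch_model M" and bounds: "error_bounds (horizon M) \<Delta>P \<Delta>H"
  shows "solves_robust_dispatch_within shortest_path_program (1000 * Suc (card (arcs (dispatch_graph M)))) M P\<^sub>0 H\<^sub>0 \<Delta>P \<Delta>H"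
  unfolding solves_robust_dispatch_within_def
proof (intro allI impI)
  fix es \<nu> \<sigma>
  let ?G = "dispatch_graph M" and ?\<xi> = "worst_profile (horizon M) P\<^sub>0 H\<^sub>0 \<Delta>P \<Delta>H"
  let ?W = "demand_box (horizon M) P\<^sub>0 H\<^sub>0 \<Delta>P \<Delta>H"
  assume enc: "encodes ?G (arc_cost M ?\<xi>) Source Terminal es \<nu> \<sigma>"
  have M: "turbine_model M" using model by (simp add: dispatch_model_def)
  have wf: "wf_digraph ?G" using fin_digraph_dispatch_graph[OF M] by (simp add: fin_digraph_def)
  have ends: "Source \<in> verts ?G" "Terminal \<in> verts ?G" by (simp_all add: dispatch_graph_def)
  obtain n \<sigma>' p where run: "exec shortest_path_program \<sigma> n \<sigma>'" "n \<le> 1000 * Suc (card (arcs ?G))"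
      "outputs es \<sigma>' p" and
    opt: "if \<exists>r. pre_digraph.awalk ?G Source r Terminal
     then pre_digraph.awalk ?G Source p Terminal \<and> (\<forall>r. pre_digraph.awalk ?G Source r Terminal \<longrightarrow>
       sum_list (map (arc_cost M ?\<xi>) p) \<le> sum_list (map (arc_cost M ?\<xi>) r))
     else p = []"
    using program_finds_shortest_path[OF wf enc ends vertex_time_less[OF M]] by blast
  have "if dispatch_paths M = {} then p = []
     else is_arg_min (path_cost M ?\<xi>) (\<lambda>p. p \<in> dispatch_paths M) p"
  proof (cases "dispatch_paths M = {}")
    case True
    then show ?thesis using opt by (auto simp flip: dispatch_paths_conv_awalk(1)[OF M])
  next
    case False
    then have "p \<in> dispatch_paths M" and min: "\<And>r. r \<in> dispatch_paths M \<Longrightarrow>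
        sum_list (map (arc_cost M ?\<xi>) p) \<le> sum_list (map (arc_cost M ?\<xi>) r)"
      using opt by (auto simp flip: dispatch_paths_conv_awalk(1)[OF M] split: if_splits)
    then have "path_cost M ?\<xi> p \<le> path_cost M ?\<xi> r" if "r \<in> dispatch_paths M" for r
      using that dispatch_paths_conv_awalk(2)[OF M] by (simp add: path_cost_conv_sum_list)
    with \<open>p \<in> dispatch_paths M\<close> False show ?thesis by (auto simp: is_arg_min_def not_less)
  qed
  then have "if dispatch_paths M = {} then p = []
     else is_arg_min (robust_cost M ?W) (\<lambda>p. p \<in> dispatch_paths M) p"
    using robust_dispatch_equivalence(2)[OF model bounds] by simp
  with run show "\<exists>n \<sigma>' p. exec shortest_path_program \<sigma> n \<sigma>' \<and> n \<le> 1000 * Suc (card (arcs ?G)) \<and> outputs es \<sigma>' p \<and>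
      (if dispatch_paths M = {} then p = []
       else is_arg_min (robust_cost M ?W) (\<lambda>p. p \<in> dispatch_paths M) p)"
    by blast
qed

text \<open>
  The time bound \<open>1000 * (m + 1)\<close> for \<open>m\<close> arcs is linear in \<open>m\<close> because a
  nonempty state set yields at least one arc.
\<close>
theorem corollary1:
  "(\<forall>(M :: ('x, 'u) turbine) P\<^sub>0 H\<^sub>0 \<Delta>P \<Delta>H.
      dispatch_model M \<and> error_bounds (horizon M) \<Delta>P \<Delta>H \<longrightarrow>
      (let W = demand_box (horizon M) P\<^sub>0 H\<^sub>0 \<Delta>P \<Delta>H; \<xi> = worst_profile (horizon M) P\<^sub>0 H\<^sub>0 \<Delta>P \<Delta>H in
         (\<forall>p\<in>dispatch_paths M. (\<exists>\<xi>'\<in>W. robust_cost M W p = path_cost M \<xi>' p) \<and>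
            robust_cost M W p = path_cost M \<xi> p) \<and>
         (INF p\<in>dispatch_paths M. robust_cost M W p) = (INF p\<in>dispatch_paths M. path_cost M \<xi> p) \<and>
         (\<forall>p. is_arg_min (robust_cost M W) (\<lambda>p. p \<in> dispatch_paths M) p \<longleftrightarrow>
              is_arg_min (path_cost M \<xi>) (\<lambda>p. p \<in> dispatch_paths M) p) \<and>
         (dispatch_paths M \<noteq> {} \<longrightarrow> (\<exists>p. is_arg_min (robust_cost M W) (\<lambda>p. p \<in> dispatch_paths M) p)))) \<and>
   (\<exists>C (\<tau> :: ('x, 'u) turbine \<Rightarrow> nat).
      (\<forall>M P\<^sub>0 H\<^sub>0 \<Delta>P \<Delta>H.
         dispatch_model M \<and> states M \<noteq> {} \<and> error_bounds (horizon M) \<Delta>P \<Delta>H \<longrightarrow>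
         solves_robust_dispatch_within C (\<tau> M) M P\<^sub>0 H\<^sub>0 \<Delta>P \<Delta>H) \<and>
      (\<lambda>M. real (\<tau> M)) \<in>
        O[principal {M. dispatch_model M \<and> states M \<noteq> {}}](\<lambda>M. real (card (arcs (dispatch_graph M))))) \<and>
   (\<forall>m. (\<lambda>M :: ('x, 'u) turbine. real (card (arcs (dispatch_graph M)))) \<in>
      O[principal {M. dispatch_model M \<and> (\<forall>x\<in>states M. card (controls M x) \<le> m * max_duration M)}](\<lambda>M.
         real (max_duration M * card (states M) * horizon M)))"
proof (intro conjI)
  show "\<forall>(M :: ('x, 'u) turbine) P\<^sub>0 H\<^sub>0 \<Delta>P \<Delta>H.
      dispatch_model M \<and> error_bounds (horizon M) \<Delta>P \<Delta>H \<longrightarrow>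
      (let W = demand_box (horizon M) P\<^sub>0 H\<^sub>0 \<Delta>P \<Delta>H; \<xi> = worst_profile (horizon M) P\<^sub>0 H\<^sub>0 \<Delta>P \<Delta>H in
         (\<forall>p\<in>dispatch_paths M. (\<exists>\<xi>'\<in>W. robust_cost M W p = path_cost M \<xi>' p) \<and>
            robust_cost M W p = path_cost M \<xi> p) \<and>
         (INF p\<in>dispatch_paths M. robust_cost M W p) = (INF p\<in>dispatch_paths M. path_cost M \<xi> p) \<and>
         (\<forall>p. is_arg_min (robust_cost M W) (\<lambda>p. p \<in> dispatch_paths M) p \<longleftrightarrow>
              is_arg_min (path_cost M \<xi>) (\<lambda>p. p \<in> dispatch_paths M) p) \<and>
         (dispatch_paths M \<noteq> {} \<longrightarrow> (\<exists>p. is_arg_min (robust_cost M W) (\<lambda>p. p \<in> dispatch_paths M) p)))"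
    unfolding Let_def
  proof (intro allI impI, elim conjE)
    fix M :: "('x, 'u) turbine" and P\<^sub>0 H\<^sub>0 \<Delta>P \<Delta>H
    let ?W = "demand_box (horizon M) P\<^sub>0 H\<^sub>0 \<Delta>P \<Delta>H" and ?\<xi> = "worst_profile (horizon M) P\<^sub>0 H\<^sub>0 \<Delta>P \<Delta>H"
    assume M: "dispatch_model M" and bounds: "error_bounds (horizon M) \<Delta>P \<Delta>H"
    note eq = robust_dispatch_equivalence[OF M bounds, where P\<^sub>0 = P\<^sub>0 and H\<^sub>0 = H\<^sub>0]
    have "finite (dispatch_paths M)"
      using M by (intro finite_dispatch_paths) (simp add: dispatch_model_def)
    then have "dispatch_paths M \<noteq> {} \<longrightarrow> (\<exists>p. is_arg_min (robust_cost M ?W) (\<lambda>p. p \<in> dispatch_paths M) p)"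
      by (blast intro: ex_is_arg_min_if_finite)
    moreover have "?\<xi> \<in> ?W" using bounds by (rule worst_profile_in_demand_box)
    moreover have "(INF p\<in>dispatch_paths M. robust_cost M ?W p) = (INF p\<in>dispatch_paths M. path_cost M ?\<xi> p)"
      using eq(1) by (intro INF_cong) auto
    ultimately show "(\<forall>p\<in>dispatch_paths M. (\<exists>\<xi>'\<in>?W. robust_cost M ?W p = path_cost M \<xi>' p) \<and>
            robust_cost M ?W p = path_cost M ?\<xi> p) \<and>
         (INF p\<in>dispatch_paths M. robust_cost M ?W p) = (INF p\<in>dispatch_paths M. path_cost M ?\<xi> p) \<and>
         (\<forall>p. is_arg_min (robust_cost M ?W) (\<lambda>p. p \<in> dispatch_paths M) p \<longleftrightarrow>
              is_arg_min (path_cost M ?\<xi>) (\<lambda>p. p \<in> dispatch_paths M) p) \<and>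
         (dispatch_paths M \<noteq> {} \<longrightarrow> (\<exists>p. is_arg_min (robust_cost M ?W) (\<lambda>p. p \<in> dispatch_paths M) p))"
      using eq by blast
  qed
next
  let ?A = "\<lambda>M :: ('x, 'u) turbine. card (arcs (dispatch_graph M))"
  have "(\<lambda>M. real (1000 * Suc (?A M))) \<in> O[principal {M. dispatch_model M \<and> states M \<noteq> {}}](\<lambda>M. real (?A M))"
  proof (rule bigoI[of _ 2000], simp only: eventually_principal, intro ballI)
    fix M :: "('x, 'u) turbine" assume "M \<in> {M. dispatch_model M \<and> states M \<noteq> {}}"
    then have M: "turbine_model M" and "states M \<noteq> {}" by (auto simp: dispatch_model_def)
    then have "1 \<le> card (states M)" by (simp add: turbine_model_def Suc_le_eq card_gt_0_iff)
    also have "\<dots> \<le> ?A M" using M by (rule card_states_le_card_arcs)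
    finally show "norm (real (1000 * Suc (?A M))) \<le> 2000 * norm (real (?A M))" by simp
  qed
  then show "\<exists>C (\<tau> :: ('x, 'u) turbine \<Rightarrow> nat).
      (\<forall>M P\<^sub>0 H\<^sub>0 \<Delta>P \<Delta>H.
         dispatch_model M \<and> states M \<noteq> {} \<and> error_bounds (horizon M) \<Delta>P \<Delta>H \<longrightarrow>
         solves_robust_dispatch_within C (\<tau> M) M P\<^sub>0 H\<^sub>0 \<Delta>P \<Delta>H) \<and>
      (\<lambda>M. real (\<tau> M)) \<in>
        O[principal {M. dispatch_model M \<and> states M \<noteq> {}}](\<lambda>M. real (card (arcs (dispatch_graph M))))"
    using program_solves_robust_dispatch
    by (intro exI[of _ shortest_path_program] exI[of _ "\<lambda>M. 1000 * Suc (?A M)"]) blast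
next
  show "\<forall>m. (\<lambda>M :: ('x, 'u) turbine. real (card (arcs (dispatch_graph M)))) \<in>
      O[principal {M. dispatch_model M \<and> (\<forall>x\<in>states M. card (controls M x) \<le> m * max_duration M)}](\<lambda>M.
         real (max_duration M * card (states M) * horizon M))"
  proof (intro allI, rule bigoI)
    fix m
    have "norm (real (card (arcs (dispatch_graph M)))) \<le>
        real (m + 2) * norm (real (max_duration M * card (states M) * horizon M))"
      if "dispatch_model M" "\<forall>x\<in>states M. card (controls M x) \<le> m * max_duration M"
      for M :: "('x, 'u) turbine"
      using card_arcs_le[of M m] that
      unfolding dispatch_model_def real_norm_def abs_of_nat of_nat_mult[symmetric] of_nat_le_iff by blast
    then show "eventually (\<lambda>M :: ('x, 'u) turbine. norm (real (card (arcs (dispatch_graph M)))) \<le>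
        real (m + 2) * norm (real (max_duration M * card (states M) * horizon M)))
      (principal {M. dispatch_model M \<and> (\<forall>x\<in>states M. card (controls M x) \<le> m * max_duration M)})"
      unfolding eventually_principal by blast
  qed
qed

end
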